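(* The category of $\text{cat}^1$-algebras with bracket and the category of crossed modules of algebras with bracket (over a fixed field $\mathbb{K}$) are equivalent.
   Context: $\mathbb{K}$ is a fixed field; all vector spaces and algebras are over $\mathbb{K}$. An algebra with bracket (AWB) is an associative, not necessarily commutative (and not necessarily unital) algebra $\mathsf{A}$ with a bilinear map $[-,-]:\mathsf{A}\times\mathsf{A}\to\mathsf{A}$ such that $[ab,c]=[a,c]b+a[b,c]$ for all $a,b,c$. Homomorphisms of AWBs are homomorphisms of associative algebras preserving the bracket. A subalgebra is a subspace closed under product and bracket. Action: an action of an AWB $\mathsf{A}$ on an AWB $\mathsf{M}$ consists of four bilinear maps $(a,m)\mapsto{}^{a\cdot}m$, $(m,a)\mapsto m^{\cdot a}$, $(a,m)\mapsto{}^{a\ast}m$, $(m,a)\mapsto m^{\ast a}$ with values in $\mathsf{M}$ such that for all $a,a_1,a_2\in\mathsf{A}$, $m,m_1,m_2\in\mathsf{M}$: ${}^{(a_1a_2)\cdot}m={}^{a_1\cdot}({}^{a_2\cdot}m)$; $\ m^{\cdot(a_1a_2)}=(m^{\cdot a_1})^{\cdot a_2}$; $\ ({}^{a_1\cdot}m)^{\cdot a_2}={}^{a_1\cdot}(m^{\cdot a_2})$; $({}^{a_1\cdot}m)^{\ast a_2}={}^{a_1\cdot}(m^{\ast a_2})+{}^{[a_1,a_2]\cdot}m$; $\ (m^{\cdot a_1})^{\ast a_2}=(m^{\ast a_2})^{\cdot a_1}+m^{\cdot[a_1,a_2]}$; $\ {}^{(a_1a_2)\ast}m={}^{a_1\cdot}({}^{a_2\ast}m)+({}^{a_1\ast}m)^{\cdot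 a_2}$; $(m_1m_2)^{\cdot a}=m_1(m_2^{\cdot a})$; $\ {}^{a\cdot}(m_1m_2)=({}^{a\cdot}m_1)m_2$; $\ (m_1^{\cdot a})m_2=m_1({}^{a\cdot}m_2)$; $[m_1^{\cdot a},m_2]=m_1({}^{a\ast}m_2)+[m_1,m_2]^{\cdot a}$; $\ [{}^{a\cdot}m_1,m_2]={}^{a\cdot}[m_1,m_2]+({}^{a\ast}m_2)m_1$; $\ (m_1m_2)^{\ast a}=m_1(m_2^{\ast a})+(m_1^{\ast a})m_2$. Crossed module: a homomorphism of AWBs $\mu:\mathsf{M}\to\mathsf{A}$ together with an action of $\mathsf{A}$ on $\mathsf{M}$ such that for all $m,m'\in\mathsf{M}$, $a\in\mathsf{A}$: (CM1) $\mu(m^{\cdot a})=\mu(m)a$, $\mu({}^{a\cdot}m)=a\mu(m)$, $\mu(m^{\ast a})=[\mu(m),a]$, $\mu({}^{a\ast}m)=[a,\mu(m)]$; (CM2) ${}^{\mu(m)\cdot}m'=mm'=m^{\cdot\mu(m')}$ and ${}^{\mu(m)\ast}m'=[m,m']=m^{\ast\mu(m')}$. A morphism from $(\mu:\mathsf{M}\to\mathsf{A})$ to $(\mu':\mathsf{M}'\to\mathsf{A}')$ is a pair of AWB homomorphisms $\alpha:\mathsf{M}\to\mathsf{M}'$, $\beta:\mathsf{A}\to\mathsf{A}'$ with $\beta\circ\mu=\mu'\circ\alpha$ and $\alpha({}^{a\cdot}m)={}^{\beta(a)\cdot}\alpha(m)$, $\alpha(m^{\cdot a})=\alpha(m)^{\cdot\beta(a)}$,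 $\alpha({}^{a\ast}m)={}^{\beta(a)\ast}\alpha(m)$, $\alpha(m^{\ast a})=\alpha(m)^{\ast\beta(a)}$. $\text{cat}^1$-AWB: a quadruple $(\mathsf{R},\mathsf{P},s,t)$ consisting of an AWB $\mathsf{R}$, a subalgebra $\mathsf{P}$ of $\mathsf{R}$ and two AWB homomorphisms $s,t:\mathsf{R}\to\mathsf{P}$ such that (a) $s|_{\mathsf{P}}=t|_{\mathsf{P}}=\mathrm{Id}_{\mathsf{P}}$; (b) $\mathrm{Ker}(s)\,\mathrm{Ker}(t)=0=\mathrm{Ker}(t)\,\mathrm{Ker}(s)$; (c) $[\mathrm{Ker}(s),\mathrm{Ker}(t)]=0=[\mathrm{Ker}(t),\mathrm{Ker}(s)]$. A morphism $(\mathsf{R},\mathsf{P},s,t)\to(\mathsf{R}',\mathsf{P}',s',t')$ is an AWB homomorphism $f:\mathsf{R}\to\mathsf{R}'$ with $f(\mathsf{P})\subseteq\mathsf{P}'$, $s'\circ f=f|_{\mathsf{P}}\circ s$ and $t'\circ f=f|_{\mathsf{P}}\circ t$. *)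

theory Defs
  imports "HOL-Algebra.Module" "HOL-Algebra.AbelCoset" "HOL-Library.FuncSet"
begin

section \<open>Categories and equivalences of categories\<close>

text \<open>
  Arrows do not carry their source and target, so composition is indexed by the three objects:
  \<open>Comp C X Y Z g f\<close> is the composite of \<open>f : X \<rightarrow> Y\<close> followed by \<open>g : Y \<rightarrow> Z\<close>.
  All data are relevant only on \<open>Ob C\<close> and on the hom-sets between its members.
\<close>

record ('o, 'm) cat =
  Ob :: "'o set"
  Hom :: "'o \<Rightarrow> 'o \<Rightarrow> 'm set"
  Ident :: "'o \<Rightarrow> 'm"
  Comp :: "'o \<Rightarrow> 'o \<Rightarrow> 'o \<Rightarrow> 'm \<Rightarrow> 'm \<Rightarrow> 'm"

locale category =
  fixes C :: "('o, 'm) cat"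
  assumes Ident_in_Hom: "X \<in> Ob C \<Longrightarrow> Ident C X \<in> Hom C X X"
    and Comp_in_Hom:
      "\<lbrakk>X \<in> Ob C; Y \<in> Ob C; Z \<in> Ob C; f \<in> Hom C X Y; g \<in> Hom C Y Z\<rbrakk>
        \<Longrightarrow> Comp C X Y Z g f \<in> Hom C X Z"
    and Comp_Ident_left:
      "\<lbrakk>X \<in> Ob C; Y \<in> Ob C; f \<in> Hom C X Y\<rbrakk> \<Longrightarrow> Comp C X Y Y (Ident C Y) f = f"
    and Comp_Ident_right:
      "\<lbrakk>X \<in> Ob C; Y \<in> Ob C; f \<in> Hom C X Y\<rbrakk> \<Longrightarrow> Comp C X X Y f (Ident C X) = f"
    and Comp_assoc:
      "\<lbrakk>W \<in> Ob C; X \<in> Ob C; Y \<in> Ob C; Z \<in> Ob C;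
        f \<in> Hom C W X; g \<in> Hom C X Y; h \<in> Hom C Y Z\<rbrakk>
        \<Longrightarrow> Comp C W Y Z h (Comp C W X Y g f) = Comp C W X Z (Comp C X Y Z h g) f"

record ('o1, 'm1, 'o2, 'm2) funct =
  obj_map :: "'o1 \<Rightarrow> 'o2"
  arr_map :: "'o1 \<Rightarrow> 'o1 \<Rightarrow> 'm1 \<Rightarrow> 'm2"

locale is_functor =
  fixes C :: "('o1, 'm1) cat" and D :: "('o2, 'm2) cat" and F :: "('o1, 'm1, 'o2, 'm2) funct"
  assumes obj_map_in_Ob: "X \<in> Ob C \<Longrightarrow> obj_map F X \<in> Ob D"
    and arr_map_in_Hom:
      "\<lbrakk>X \<in> Ob C; Y \<in> Ob C; f \<in> Hom C X Y\<rbrakk>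
        \<Longrightarrow> arr_map F X Y f \<in> Hom D (obj_map F X) (obj_map F Y)"
    and arr_map_Ident:
      "X \<in> Ob C \<Longrightarrow> arr_map F X X (Ident C X) = Ident D (obj_map F X)"
    and arr_map_Comp:
      "\<lbrakk>X \<in> Ob C; Y \<in> Ob C; Z \<in> Ob C; f \<in> Hom C X Y; g \<in> Hom C Y Z\<rbrakk>
        \<Longrightarrow> arr_map F X Z (Comp C X Y Z g f) =
            Comp D (obj_map F X) (obj_map F Y) (obj_map F Z) (arr_map F Y Z g) (arr_map F X Y f)"

definition id_funct :: "('o, 'm, 'o, 'm) funct" where
  "id_funct = \<lparr>obj_map = (\<lambda>X. X), arr_map = (\<lambda>X Y f. f)\<rparr>"

definition comp_funct ::
    "('o2, 'm2, 'o3, 'm3) funct \<Rightarrow> ('o1, 'm1, 'o2, 'm2) funct \<Rightarrow> ('o1, 'm1, 'o3, 'm3) funct" where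
  "comp_funct G F =
    \<lparr>obj_map = (\<lambda>X. obj_map G (obj_map F X)),
     arr_map = (\<lambda>X Y f. arr_map G (obj_map F X) (obj_map F Y) (arr_map F X Y f))\<rparr>"

definition is_iso :: "('o, 'm) cat \<Rightarrow> 'o \<Rightarrow> 'o \<Rightarrow> 'm \<Rightarrow> bool" where
  "is_iso C X Y f \<longleftrightarrow> f \<in> Hom C X Y \<and>
    (\<exists>g \<in> Hom C Y X. Comp C X Y X g f = Ident C X \<and> Comp C Y X Y f g = Ident C Y)"

definition is_natural_iso ::
    "('o1, 'm1) cat \<Rightarrow> ('o2, 'm2) cat \<Rightarrow> ('o1, 'm1, 'o2, 'm2) funct \<Rightarrow> ('o1, 'm1, 'o2, 'm2) funct
      \<Rightarrow> ('o1 \<Rightarrow> 'm2) \<Rightarrow> bool" where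
  "is_natural_iso C D F G \<eta> \<longleftrightarrow>
    (\<forall>X \<in> Ob C. is_iso D (obj_map F X) (obj_map G X) (\<eta> X)) \<and>
    (\<forall>X \<in> Ob C. \<forall>Y \<in> Ob C. \<forall>f \<in> Hom C X Y.
      Comp D (obj_map F X) (obj_map F Y) (obj_map G Y) (\<eta> Y) (arr_map F X Y f) =
      Comp D (obj_map F X) (obj_map G X) (obj_map G Y) (arr_map G X Y f) (\<eta> X))"

definition naturally_isomorphic ::
    "('o1, 'm1) cat \<Rightarrow> ('o2, 'm2) cat \<Rightarrow> ('o1, 'm1, 'o2, 'm2) funct \<Rightarrow> ('o1, 'm1, 'o2, 'm2) funct
      \<Rightarrow> bool" where
  "naturally_isomorphic C D F G \<longleftrightarrow> (\<exists>\<eta>. is_natural_iso C D F G \<eta>)"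

definition equivalent_categories :: "('o1, 'm1) cat \<Rightarrow> ('o2, 'm2) cat \<Rightarrow> bool" where
  "equivalent_categories C D \<longleftrightarrow> category C \<and> category D \<and>
    (\<exists>F G. is_functor C D F \<and> is_functor D C G \<and>
      naturally_isomorphic C C (comp_funct G F) id_funct \<and>
      naturally_isomorphic D D (comp_funct F G) id_funct)"


section \<open>Algebras with bracket\<close>

text \<open>
  The underlying record is that of HOL-Algebra modules, whose field \<open>mult\<close> carries the associative
  product. Algebras need not be unital, and the inherited field \<open>one\<close> is never used.
\<close>

record ('k, 'a) awb = "('k, 'a) module" +
  bracket :: "'a \<Rightarrow> 'a \<Rightarrow> 'a"

definition bilinear_map ::
    "('k, 'r) ring_scheme \<Rightarrow> ('k, 'a, 'x) module_scheme \<Rightarrow> ('k, 'b, 'y) module_scheme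
      \<Rightarrow> ('k, 'c, 'z) module_scheme \<Rightarrow> ('a \<Rightarrow> 'b \<Rightarrow> 'c) \<Rightarrow> bool" where
  "bilinear_map K U V W b \<longleftrightarrow>
    (\<forall>u \<in> carrier U. \<forall>v \<in> carrier V. b u v \<in> carrier W) \<and>
    (\<forall>u \<in> carrier U. \<forall>u' \<in> carrier U. \<forall>v \<in> carrier V.
      b (u \<oplus>\<^bsub>U\<^esub> u') v = b u v \<oplus>\<^bsub>W\<^esub> b u' v) \<and>
    (\<forall>u \<in> carrier U. \<forall>v \<in> carrier V. \<forall>v' \<in> carrier V.
      b u (v \<oplus>\<^bsub>V\<^esub> v') = b u v \<oplus>\<^bsub>W\<^esub> b u v') \<and>
    (\<forall>k \<in> carrier K. \<forall>u \<in> carrier U. \<forall>v \<in> carrier V.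
      b (k \<odot>\<^bsub>U\<^esub> u) v = k \<odot>\<^bsub>W\<^esub> b u v \<and> b u (k \<odot>\<^bsub>V\<^esub> v) = k \<odot>\<^bsub>W\<^esub> b u v)"

locale algebra_with_bracket = field K + module K A
  for K :: "('k, 'r) ring_scheme" and A :: "('k, 'a) awb" +
  assumes mult_bilinear: "bilinear_map K A A A (mult A)"
    and mult_assoc:
      "\<lbrakk>a \<in> carrier A; b \<in> carrier A; c \<in> carrier A\<rbrakk>
        \<Longrightarrow> (a \<otimes>\<^bsub>A\<^esub> b) \<otimes>\<^bsub>A\<^esub> c = a \<otimes>\<^bsub>A\<^esub> (b \<otimes>\<^bsub>A\<^esub> c)"
    and bracket_bilinear: "bilinear_map K A A A (bracket A)"
    and bracket_mult:
      "\<lbrakk>a \<in> carrier A; b \<in> carrier A; c \<in> carrier A\<rbrakk>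
        \<Longrightarrow> bracket A (a \<otimes>\<^bsub>A\<^esub> b) c = (bracket A a c \<otimes>\<^bsub>A\<^esub> b) \<oplus>\<^bsub>A\<^esub> (a \<otimes>\<^bsub>A\<^esub> bracket A b c)"

definition awb_hom ::
    "('k, 'r) ring_scheme \<Rightarrow> ('k, 'a) awb \<Rightarrow> ('k, 'b) awb \<Rightarrow> ('a \<Rightarrow> 'b) set" where
  "awb_hom K A B =
    {f \<in> carrier A \<rightarrow> carrier B.
      (\<forall>x \<in> carrier A. \<forall>y \<in> carrier A.
        f (x \<oplus>\<^bsub>A\<^esub> y) = f x \<oplus>\<^bsub>B\<^esub> f y \<and>
        f (x \<otimes>\<^bsub>A\<^esub> y) = f x \<otimes>\<^bsub>B\<^esub> f y \<and>
        f (bracket A x y) = bracket B (f x) (f y)) \<and>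
      (\<forall>k \<in> carrier K. \<forall>x \<in> carrier A. f (k \<odot>\<^bsub>A\<^esub> x) = k \<odot>\<^bsub>B\<^esub> f x)}"

definition awb_subalgebra ::
    "('k, 'r) ring_scheme \<Rightarrow> 'a set \<Rightarrow> ('k, 'a) awb \<Rightarrow> bool" where
  "awb_subalgebra K P A \<longleftrightarrow> submodule P K A \<and>
    (\<forall>x \<in> P. \<forall>y \<in> P. x \<otimes>\<^bsub>A\<^esub> y \<in> P \<and> bracket A x y \<in> P)"


section \<open>Crossed modules of algebras with bracket\<close>

text \<open>
  The four maps of an action are curried in the order in which they are written:
  \<open>ld a m\<close> is \<open>\<^sup>a\<^sup>\<cdot>m\<close>, \<open>rd m a\<close> is \<open>m\<^sup>\<cdot>\<^sup>a\<close>, \<open>ls a m\<close> is \<open>\<^sup>a\<^sup>*m\<close> and \<open>rs m a\<close> is \<open>m\<^sup>*\<^sup>a\<close>.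
\<close>

locale awb_action = A: algebra_with_bracket K A + M: algebra_with_bracket K M
  for K :: "('k, 'r) ring_scheme" and A :: "('k, 'a) awb" and M :: "('k, 'm) awb" +
  fixes ld :: "'a \<Rightarrow> 'm \<Rightarrow> 'm" and rd :: "'m \<Rightarrow> 'a \<Rightarrow> 'm"
    and ls :: "'a \<Rightarrow> 'm \<Rightarrow> 'm" and rs :: "'m \<Rightarrow> 'a \<Rightarrow> 'm"
  assumes ld_bilinear: "bilinear_map K A M M ld"
    and rd_bilinear: "bilinear_map K M A M rd"
    and ls_bilinear: "bilinear_map K A M M ls"
    and rs_bilinear: "bilinear_map K M A M rs"
    and ld_mult:
      "\<lbrakk>a1 \<in> carrier A; a2 \<in> carrier A; m \<in> carrier M\<rbrakk> \<Longrightarrow> ld (a1 \<otimes>\<^bsub>A\<^esub> a2) m = ld a1 (ld a2 m)"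
    and rd_mult:
      "\<lbrakk>a1 \<in> carrier A; a2 \<in> carrier A; m \<in> carrier M\<rbrakk> \<Longrightarrow> rd m (a1 \<otimes>\<^bsub>A\<^esub> a2) = rd (rd m a1) a2"
    and ld_rd:
      "\<lbrakk>a1 \<in> carrier A; a2 \<in> carrier A; m \<in> carrier M\<rbrakk> \<Longrightarrow> rd (ld a1 m) a2 = ld a1 (rd m a2)"
    and rs_ld:
      "\<lbrakk>a1 \<in> carrier A; a2 \<in> carrier A; m \<in> carrier M\<rbrakk>
        \<Longrightarrow> rs (ld a1 m) a2 = ld a1 (rs m a2) \<oplus>\<^bsub>M\<^esub> ld (bracket A a1 a2) m"
    and rs_rd:
      "\<lbrakk>a1 \<in> carrier A; a2 \<in> carrier A; m \<in> carrier M\<rbrakk>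
        \<Longrightarrow> rs (rd m a1) a2 = rd (rs m a2) a1 \<oplus>\<^bsub>M\<^esub> rd m (bracket A a1 a2)"
    and ls_mult:
      "\<lbrakk>a1 \<in> carrier A; a2 \<in> carrier A; m \<in> carrier M\<rbrakk>
        \<Longrightarrow> ls (a1 \<otimes>\<^bsub>A\<^esub> a2) m = ld a1 (ls a2 m) \<oplus>\<^bsub>M\<^esub> rd (ls a1 m) a2"
    and mult_rd:
      "\<lbrakk>a \<in> carrier A; m1 \<in> carrier M; m2 \<in> carrier M\<rbrakk>
        \<Longrightarrow> rd (m1 \<otimes>\<^bsub>M\<^esub> m2) a = m1 \<otimes>\<^bsub>M\<^esub> rd m2 a"
    and ld_mult_M:
      "\<lbrakk>a \<in> carrier A; m1 \<in> carrier M; m2 \<in> carrier M\<rbrakk>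
        \<Longrightarrow> ld a (m1 \<otimes>\<^bsub>M\<^esub> m2) = ld a m1 \<otimes>\<^bsub>M\<^esub> m2"
    and rd_mult_ld:
      "\<lbrakk>a \<in> carrier A; m1 \<in> carrier M; m2 \<in> carrier M\<rbrakk>
        \<Longrightarrow> rd m1 a \<otimes>\<^bsub>M\<^esub> m2 = m1 \<otimes>\<^bsub>M\<^esub> ld a m2"
    and bracket_rd:
      "\<lbrakk>a \<in> carrier A; m1 \<in> carrier M; m2 \<in> carrier M\<rbrakk>
        \<Longrightarrow> bracket M (rd m1 a) m2 = (m1 \<otimes>\<^bsub>M\<^esub> ls a m2) \<oplus>\<^bsub>M\<^esub> rd (bracket M m1 m2) a"
    and bracket_ld:
      "\<lbrakk>a \<in> carrier A; m1 \<in> carrier M; m2 \<in> carrier M\<rbrakk>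
        \<Longrightarrow> bracket M (ld a m1) m2 = ld a (bracket M m1 m2) \<oplus>\<^bsub>M\<^esub> (ls a m2 \<otimes>\<^bsub>M\<^esub> m1)"
    and mult_rs:
      "\<lbrakk>a \<in> carrier A; m1 \<in> carrier M; m2 \<in> carrier M\<rbrakk>
        \<Longrightarrow> rs (m1 \<otimes>\<^bsub>M\<^esub> m2) a = (m1 \<otimes>\<^bsub>M\<^esub> rs m2 a) \<oplus>\<^bsub>M\<^esub> (rs m1 a \<otimes>\<^bsub>M\<^esub> m2)"

record ('k, 'm, 'a) xmod =
  XM :: "('k, 'm) awb"
  XA :: "('k, 'a) awb"
  bdry :: "'m \<Rightarrow> 'a"
  ldot :: "'a \<Rightarrow> 'm \<Rightarrow> 'm"
  rdot :: "'m \<Rightarrow> 'a \<Rightarrow> 'm"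
  lstar :: "'a \<Rightarrow> 'm \<Rightarrow> 'm"
  rstar :: "'m \<Rightarrow> 'a \<Rightarrow> 'm"

definition crossed_module :: "('k, 'r) ring_scheme \<Rightarrow> ('k, 'm, 'a) xmod \<Rightarrow> bool" where
  "crossed_module K X \<longleftrightarrow>
    awb_action K (XA X) (XM X) (ldot X) (rdot X) (lstar X) (rstar X) \<and>
    bdry X \<in> awb_hom K (XM X) (XA X) \<and>
    (\<forall>m \<in> carrier (XM X). \<forall>a \<in> carrier (XA X).
      bdry X (rdot X m a) = bdry X m \<otimes>\<^bsub>XA X\<^esub> a \<and>
      bdry X (ldot X a m) = a \<otimes>\<^bsub>XA X\<^esub> bdry X m \<and>
      bdry X (rstar X m a) = bracket (XA X) (bdry X m) a \<and>
      bdry X (lstar X a m) = bracket (XA X) a (bdry X m)) \<and>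
    (\<forall>m \<in> carrier (XM X). \<forall>m' \<in> carrier (XM X).
      ldot X (bdry X m) m' = m \<otimes>\<^bsub>XM X\<^esub> m' \<and>
      m \<otimes>\<^bsub>XM X\<^esub> m' = rdot X m (bdry X m') \<and>
      lstar X (bdry X m) m' = bracket (XM X) m m' \<and>
      bracket (XM X) m m' = rstar X m (bdry X m'))"

text \<open>
  Functions in HOL are total; arrows of the categories below are required to be \<open>extensional\<close>,
  that is, \<open>undefined\<close> off the carrier of their source, so that two arrows are equal exactly when
  they agree on that carrier.
\<close>

definition xmod_hom ::
    "('k, 'r) ring_scheme \<Rightarrow> ('k, 'm, 'a) xmod \<Rightarrow> ('k, 'n, 'b) xmod
      \<Rightarrow> (('m \<Rightarrow> 'n) \<times> ('a \<Rightarrow> 'b)) set" where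
  "xmod_hom K X Y =
    {(\<alpha>, \<beta>).
      \<alpha> \<in> awb_hom K (XM X) (XM Y) \<and> \<alpha> \<in> extensional (carrier (XM X)) \<and>
      \<beta> \<in> awb_hom K (XA X) (XA Y) \<and> \<beta> \<in> extensional (carrier (XA X)) \<and>
      (\<forall>m \<in> carrier (XM X). \<beta> (bdry X m) = bdry Y (\<alpha> m)) \<and>
      (\<forall>a \<in> carrier (XA X). \<forall>m \<in> carrier (XM X).
        \<alpha> (ldot X a m) = ldot Y (\<beta> a) (\<alpha> m) \<and>
        \<alpha> (rdot X m a) = rdot Y (\<alpha> m) (\<beta> a) \<and>
        \<alpha> (lstar X a m) = lstar Y (\<beta> a) (\<alpha> m) \<and>
        \<alpha> (rstar X m a) = rstar Y (\<alpha> m) (\<beta> a))}"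

text \<open>
  The underlying sets of all algebras involved are subsets of one type \<open>'u\<close>, which plays the role
  of the universe.
\<close>

definition xmod_cat ::
    "('k, 'r) ring_scheme \<Rightarrow> (('k, 'u, 'u) xmod, ('u \<Rightarrow> 'u) \<times> ('u \<Rightarrow> 'u)) cat" where
  "xmod_cat K =
    \<lparr>Ob = {X. crossed_module K X},
     Hom = xmod_hom K,
     Ident = (\<lambda>X. (restrict (\<lambda>m. m) (carrier (XM X)), restrict (\<lambda>a. a) (carrier (XA X)))),
     Comp = (\<lambda>X Y Z g f.
       (compose (carrier (XM X)) (fst g) (fst f), compose (carrier (XA X)) (snd g) (snd f)))\<rparr>"


section \<open>Cat1-algebras with bracket\<close>

record ('k, 'a) cat1 =
  CR :: "('k, 'a) awb"
  CP :: "'a set"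
  src :: "'a \<Rightarrow> 'a"
  tgt :: "'a \<Rightarrow> 'a"

abbreviation sub_awb :: "('k, 'a) awb \<Rightarrow> 'a set \<Rightarrow> ('k, 'a) awb" where
  "sub_awb A P \<equiv> A\<lparr>carrier := P\<rparr>"

definition cat1_awb :: "('k, 'r) ring_scheme \<Rightarrow> ('k, 'a) cat1 \<Rightarrow> bool" where
  "cat1_awb K X \<longleftrightarrow>
    algebra_with_bracket K (CR X) \<and>
    awb_subalgebra K (CP X) (CR X) \<and>
    src X \<in> awb_hom K (CR X) (sub_awb (CR X) (CP X)) \<and>
    tgt X \<in> awb_hom K (CR X) (sub_awb (CR X) (CP X)) \<and>
    (\<forall>p \<in> CP X. src X p = p \<and> tgt X p = p) \<and>
    (\<forall>x \<in> a_kernel (CR X) (sub_awb (CR X) (CP X)) (src X).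
     \<forall>y \<in> a_kernel (CR X) (sub_awb (CR X) (CP X)) (tgt X).
      x \<otimes>\<^bsub>CR X\<^esub> y = \<zero>\<^bsub>CR X\<^esub> \<and> y \<otimes>\<^bsub>CR X\<^esub> x = \<zero>\<^bsub>CR X\<^esub> \<and>
      bracket (CR X) x y = \<zero>\<^bsub>CR X\<^esub> \<and> bracket (CR X) y x = \<zero>\<^bsub>CR X\<^esub>)"

definition cat1_hom ::
    "('k, 'r) ring_scheme \<Rightarrow> ('k, 'a) cat1 \<Rightarrow> ('k, 'b) cat1 \<Rightarrow> ('a \<Rightarrow> 'b) set" where
  "cat1_hom K X Y =
    {f \<in> awb_hom K (CR X) (CR Y).
      f \<in> extensional (carrier (CR X)) \<and>
      f ` CP X \<subseteq> CP Y \<and>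
      (\<forall>x \<in> carrier (CR X). src Y (f x) = f (src X x) \<and> tgt Y (f x) = f (tgt X x))}"

definition cat1_cat :: "('k, 'r) ring_scheme \<Rightarrow> (('k, 'u) cat1, 'u \<Rightarrow> 'u) cat" where
  "cat1_cat K =
    \<lparr>Ob = {X. cat1_awb K X},
     Hom = cat1_hom K,
     Ident = (\<lambda>X. restrict (\<lambda>x. x) (carrier (CR X))),
     Comp = (\<lambda>X Y Z g f. compose (carrier (CR X)) g f)\<rparr>"

end

theory Submission
  imports Defs
begin

text \<open>
  A cat1-structure on \<open>R\<close> is an internal category in algebras with bracket whose objects are \<open>P\<close>,
  and the passage to crossed modules is the usual one: everything is determined by \<open>P\<close> and by the
  arrows \<open>N = Ker s\<close> that start at zero.

  From \<open>(R, P, s, t)\<close> one obtains the crossed module \<open>t : N \<rightarrow> P\<close>, where \<open>P\<close> acts on the ideal \<open>N\<close>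
  by the product and the bracket of \<open>R\<close>; the action axioms are then instances of associativity and
  of the bracket identity. Axiom (CM2) is a reformulation of the kernel conditions: since
  \<open>m - t m\<close> lies in \<open>Ker t\<close>, it is annihilated by every \<open>n \<in> N\<close>, whence \<open>t m\<close> and \<open>m\<close> multiply and
  bracket alike with \<open>n\<close> (lemma \<open>peiffer\<close>).

  Conversely, the twelve action axioms are exactly the cases of associativity and of the bracket
  identity in the semidirect product \<open>M \<rtimes> A\<close> in which elements of \<open>M\<close> and of \<open>A\<close> are mixed. The
  projection \<open>(m, a) \<mapsto> a\<close> serves as \<open>s\<close> and the map \<open>(m, a) \<mapsto> \<mu> m + a\<close>, a homomorphism by (CM1),
  serves as \<open>t\<close>. An element \<open>(n, a)\<close> of \<open>Ker t\<close> has \<open>\<mu> n + a = 0\<close>, so by (CM2) its product with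
  \<open>(m, 0)\<close> is \<open>m n + m \<cdot> a = m \<cdot> (\<mu> n + a) = 0\<close> (lemma \<open>tgt_kernel_annihilates\<close>).

  The two constructions are mutually inverse up to natural isomorphism. As \<open>s\<close> is a retraction
  onto \<open>P\<close>, every \<open>r\<close> splits uniquely as \<open>(r - s r) + s r\<close> with summands in \<open>N\<close> and \<open>P\<close>, so addition
  is an isomorphism \<open>N \<rtimes> P \<cong> R\<close> (\<open>recombine\<close>); and the kernel of \<open>s\<close> and the base of \<open>M \<rtimes> A\<close> are
  copies of \<open>M\<close> and \<open>A\<close> (\<open>components\<close>). In both categories a bijective arrow is invertible, so only
  the homomorphism property, bijectivity and naturality of these maps have to be checked.

  All carriers are subsets of one infinite type \<open>'u\<close>, so the pairs forming \<open>M \<rtimes> A\<close> must themselves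
  be named by elements of \<open>'u\<close>. An injection \<open>enc : 'u \<times> 'u \<rightarrow> 'u\<close>, fixed once and for all, does this;
  it exists because an infinite set is equinumerous with its square.
\<close>

section \<open>Bilinear maps, homomorphisms and subalgebras\<close>

lemma bilinear_closed:
  "\<lbrakk>bilinear_map K U V W b; u \<in> carrier U; v \<in> carrier V\<rbrakk> \<Longrightarrow> b u v \<in> carrier W"
  and bilinear_add_left:
  "\<lbrakk>bilinear_map K U V W b; u \<in> carrier U; u' \<in> carrier U; v \<in> carrier V\<rbrakk>
    \<Longrightarrow> b (u \<oplus>\<^bsub>U\<^esub> u') v = b u v \<oplus>\<^bsub>W\<^esub> b u' v"
  and bilinear_add_right:
  "\<lbrakk>bilinear_map K U V W b; u \<in> carrier U; v \<in> carrier V; v' \<in> carrier V\<rbrakk>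
    \<Longrightarrow> b u (v \<oplus>\<^bsub>V\<^esub> v') = b u v \<oplus>\<^bsub>W\<^esub> b u v'"
  and bilinear_smult_left:
  "\<lbrakk>bilinear_map K U V W b; k \<in> carrier K; u \<in> carrier U; v \<in> carrier V\<rbrakk>
    \<Longrightarrow> b (k \<odot>\<^bsub>U\<^esub> u) v = k \<odot>\<^bsub>W\<^esub> b u v"
  and bilinear_smult_right:
  "\<lbrakk>bilinear_map K U V W b; k \<in> carrier K; u \<in> carrier U; v \<in> carrier V\<rbrakk>
    \<Longrightarrow> b u (k \<odot>\<^bsub>V\<^esub> v) = k \<odot>\<^bsub>W\<^esub> b u v"
  by (auto simp: bilinear_map_def)

lemma bilinear_zero_left:
  assumes b: "bilinear_map K U V W b" and "abelian_group U" and "abelian_group W"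
    and v: "v \<in> carrier V"
  shows "b \<zero>\<^bsub>U\<^esub> v = \<zero>\<^bsub>W\<^esub>"
proof -
  interpret U: abelian_group U by fact
  interpret W: abelian_group W by fact
  have "b \<zero>\<^bsub>U\<^esub> v \<oplus>\<^bsub>W\<^esub> b \<zero>\<^bsub>U\<^esub> v = b \<zero>\<^bsub>U\<^esub> v"
    using bilinear_add_left[OF b U.zero_closed U.zero_closed v] by simp
  then show ?thesis
    using bilinear_closed[OF b U.zero_closed v] W.add.r_cancel_one' by fastforce
qed

lemma bilinear_zero_right:
  assumes b: "bilinear_map K U V W b" and "abelian_group V" and "abelian_group W"
    and u: "u \<in> carrier U"
  shows "b u \<zero>\<^bsub>V\<^esub> = \<zero>\<^bsub>W\<^esub>"
proof -
  interpret V: abelian_group V by fact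
  interpret W: abelian_group W by fact
  have "b u \<zero>\<^bsub>V\<^esub> \<oplus>\<^bsub>W\<^esub> b u \<zero>\<^bsub>V\<^esub> = b u \<zero>\<^bsub>V\<^esub>"
    using bilinear_add_right[OF b u V.zero_closed V.zero_closed] by simp
  then show ?thesis
    using bilinear_closed[OF b u V.zero_closed] W.add.r_cancel_one' by fastforce
qed

text \<open>
  Both constituents of the crossed module of a cat1-algebra live inside one ambient algebra, and all
  of their bilinear maps are restrictions of its product and bracket.
\<close>

lemma bilinear_map_restrict:
  assumes "bilinear_map K A A A b" "U \<subseteq> carrier A" "V \<subseteq> carrier A"
    and "\<And>u v. u \<in> U \<Longrightarrow> v \<in> V \<Longrightarrow> b u v \<in> W"
  shows "bilinear_map K (sub_awb A U) (sub_awb A V) (sub_awb A W) b"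
  using assms by (auto simp: bilinear_map_def subset_iff)

context algebra_with_bracket
begin

lemma abelian_group_A: "abelian_group A" ..

lemmas add_ac = M.a_ac

lemmas prod_closed [simp, intro] = bilinear_closed[OF mult_bilinear]
lemmas prod_add_left = bilinear_add_left[OF mult_bilinear]
lemmas prod_add_right = bilinear_add_right[OF mult_bilinear]
lemmas prod_smult_left = bilinear_smult_left[OF mult_bilinear]
lemmas prod_smult_right = bilinear_smult_right[OF mult_bilinear]
lemmas prod_zero_left [simp] =
  bilinear_zero_left[OF mult_bilinear abelian_group_A abelian_group_A]
lemmas prod_zero_right [simp] =
  bilinear_zero_right[OF mult_bilinear abelian_group_A abelian_group_A]

lemmas bracket_closed [simp, intro] = bilinear_closed[OF bracket_bilinear]
lemmas bracket_add_left = bilinear_add_left[OF bracket_bilinear]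
lemmas bracket_add_right = bilinear_add_right[OF bracket_bilinear]
lemmas bracket_smult_left = bilinear_smult_left[OF bracket_bilinear]
lemmas bracket_smult_right = bilinear_smult_right[OF bracket_bilinear]
lemmas bracket_zero_left [simp] =
  bilinear_zero_left[OF bracket_bilinear abelian_group_A abelian_group_A]
lemmas bracket_zero_right [simp] =
  bilinear_zero_right[OF bracket_bilinear abelian_group_A abelian_group_A]

lemmas linear_simps =
  prod_add_left prod_add_right prod_smult_left prod_smult_right
  bracket_add_left bracket_add_right bracket_smult_left bracket_smult_right
  smult_r_distr smult_l_distr

lemma subalgebra_awb:
  assumes "awb_subalgebra K P A"
  shows "algebra_with_bracket K (sub_awb A P)"
proof -
  have sub: "submodule P K A"
    and closed: "\<And>x y. x \<in> P \<Longrightarrow> y \<in> P \<Longrightarrow> x \<otimes>\<^bsub>A\<^esub> y \<in> P \<and> bracket A x y \<in> P"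
    using assms by (auto simp: awb_subalgebra_def)
  have P: "P \<subseteq> carrier A" using submoduleE(1)[OF sub] .
  interpret P: module K "sub_awb A P"
    using submodule.submodule_is_module[OF sub module_axioms] .
  have bm: "bilinear_map K (sub_awb A P) (sub_awb A P) (sub_awb A P) (mult A)"
    and bb: "bilinear_map K (sub_awb A P) (sub_awb A P) (sub_awb A P) (bracket A)"
    using closed P
    by (auto intro!: bilinear_map_restrict mult_bilinear bracket_bilinear)
  show ?thesis
    by unfold_locales
      (use P bm bb in \<open>auto simp: subset_iff mult_assoc bracket_mult\<close>)
qed

end

lemma awb_homI:
  assumes "\<And>x. x \<in> carrier A \<Longrightarrow> f x \<in> carrier B"
    and "\<And>x y. x \<in> carrier A \<Longrightarrow> y \<in> carrier A \<Longrightarrow> f (x \<oplus>\<^bsub>A\<^esub> y) = f x \<oplus>\<^bsub>B\<^esub> f y"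
    and "\<And>x y. x \<in> carrier A \<Longrightarrow> y \<in> carrier A \<Longrightarrow> f (x \<otimes>\<^bsub>A\<^esub> y) = f x \<otimes>\<^bsub>B\<^esub> f y"
    and "\<And>x y. x \<in> carrier A \<Longrightarrow> y \<in> carrier A \<Longrightarrow> f (bracket A x y) = bracket B (f x) (f y)"
    and "\<And>k x. k \<in> carrier K \<Longrightarrow> x \<in> carrier A \<Longrightarrow> f (k \<odot>\<^bsub>A\<^esub> x) = k \<odot>\<^bsub>B\<^esub> f x"
  shows "f \<in> awb_hom K A B"
  using assms by (auto simp: awb_hom_def)

lemma awb_hom_closed: "\<lbrakk>f \<in> awb_hom K A B; x \<in> carrier A\<rbrakk> \<Longrightarrow> f x \<in> carrier B"
  and awb_hom_add: "\<lbrakk>f \<in> awb_hom K A B; x \<in> carrier A; y \<in> carrier A\<rbrakk>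
    \<Longrightarrow> f (x \<oplus>\<^bsub>A\<^esub> y) = f x \<oplus>\<^bsub>B\<^esub> f y"
  and awb_hom_mult: "\<lbrakk>f \<in> awb_hom K A B; x \<in> carrier A; y \<in> carrier A\<rbrakk>
    \<Longrightarrow> f (x \<otimes>\<^bsub>A\<^esub> y) = f x \<otimes>\<^bsub>B\<^esub> f y"
  and awb_hom_bracket: "\<lbrakk>f \<in> awb_hom K A B; x \<in> carrier A; y \<in> carrier A\<rbrakk>
    \<Longrightarrow> f (bracket A x y) = bracket B (f x) (f y)"
  and awb_hom_smult: "\<lbrakk>f \<in> awb_hom K A B; k \<in> carrier K; x \<in> carrier A\<rbrakk>
    \<Longrightarrow> f (k \<odot>\<^bsub>A\<^esub> x) = k \<odot>\<^bsub>B\<^esub> f x"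
  by (auto simp: awb_hom_def)

lemma awb_hom_zero:
  assumes f: "f \<in> awb_hom K A B" and "abelian_group A" and "abelian_group B"
  shows "f \<zero>\<^bsub>A\<^esub> = \<zero>\<^bsub>B\<^esub>"
proof -
  interpret A: abelian_group A by fact
  interpret B: abelian_group B by fact
  have "f \<zero>\<^bsub>A\<^esub> \<oplus>\<^bsub>B\<^esub> f \<zero>\<^bsub>A\<^esub> = f \<zero>\<^bsub>A\<^esub>"
    using awb_hom_add[OF f A.zero_closed A.zero_closed] by simp
  then show ?thesis
    using awb_hom_closed[OF f A.zero_closed] B.add.r_cancel_one' by fastforce
qed

lemma awb_hom_minus:
  assumes f: "f \<in> awb_hom K A B" and "abelian_group A" and "abelian_group B"
    and x: "x \<in> carrier A"
  shows "f (\<ominus>\<^bsub>A\<^esub> x) = \<ominus>\<^bsub>B\<^esub> f x"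
proof -
  interpret A: abelian_group A by fact
  interpret B: abelian_group B by fact
  have "f (\<ominus>\<^bsub>A\<^esub> x) \<oplus>\<^bsub>B\<^esub> f x = \<zero>\<^bsub>B\<^esub>"
    using awb_hom_add[OF f A.a_inv_closed[OF x] x] awb_hom_zero[OF assms(1-3)] x
    by (simp add: A.l_neg)
  then show ?thesis
    using awb_hom_closed[OF f] x by (intro B.minus_equality[symmetric]) auto
qed

lemma awb_hom_compose:
  assumes "algebra_with_bracket K A" "f \<in> awb_hom K A B" "g \<in> awb_hom K B C"
  shows "compose (carrier A) g f \<in> awb_hom K A C"
proof -
  interpret A: algebra_with_bracket K A by fact
  show ?thesis
    using assms(2,3)
    by (intro awb_homI)
      (simp_all add: compose_eq awb_hom_closed awb_hom_add awb_hom_mult awb_hom_bracket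
        awb_hom_smult)
qed

lemma awb_hom_restrict_subalgebra:
  assumes f: "f \<in> awb_hom K A B" and P: "P \<subseteq> carrier A"
    and "algebra_with_bracket K (sub_awb A P)" and im: "f ` P \<subseteq> Q"
  shows "restrict f P \<in> awb_hom K (sub_awb A P) (sub_awb B Q)"
proof -
  interpret P: algebra_with_bracket K "sub_awb A P" by fact
  note closed = P.a_closed P.prod_closed P.bracket_closed P.smult_closed
  show ?thesis
    using P im closed
    by (intro awb_homI)
      (auto simp: subset_iff image_subset_iff awb_hom_add[OF f] awb_hom_mult[OF f] awb_hom_bracket[OF f]
        awb_hom_smult[OF f])
qed

lemma awb_hom_identity:
  assumes "algebra_with_bracket K A"
  shows "restrict (\<lambda>x. x) (carrier A) \<in> awb_hom K A A"
proof -
  interpret A: algebra_with_bracket K A by fact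
  show ?thesis by (intro awb_homI) auto
qed

text \<open>
  This reduces the invertibility of an arrow to bijectivity. The inverse is cut down to the carrier
  of \<open>B\<close> because arrows are extensional.
\<close>

lemma awb_hom_inverse:
  assumes "algebra_with_bracket K A" and f: "f \<in> awb_hom K A B"
    and bij: "bij_betw f (carrier A) (carrier B)"
  shows "restrict (inv_into (carrier A) f) (carrier B) \<in> awb_hom K B A"
proof -
  interpret A: algebra_with_bracket K A by fact
  let ?g = "inv_into (carrier A) f"
  have g: "?g (f x) = x" if "x \<in> carrier A" for x
    using that bij by (simp add: bij_betw_def)
  have g_closed: "?g y \<in> carrier A" and fg: "f (?g y) = y" if "y \<in> carrier B" for y
    using that bij by (auto simp: bij_betw_def inv_into_into f_inv_into_f)
  note f_hom = awb_hom_add[OF f] awb_hom_mult[OF f] awb_hom_bracket[OF f] awb_hom_smult[OF f]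
  show ?thesis
  proof (intro awb_homI)
    fix y z assume y: "y \<in> carrier B" and z: "z \<in> carrier B"
    let ?x = "?g y" and ?w = "?g z"
    have "f (?x \<oplus>\<^bsub>A\<^esub> ?w) = y \<oplus>\<^bsub>B\<^esub> z" "f (?x \<otimes>\<^bsub>A\<^esub> ?w) = y \<otimes>\<^bsub>B\<^esub> z"
      "f (bracket A ?x ?w) = bracket B y z"
      using y z by (simp_all add: f_hom g_closed fg)
    then show "restrict ?g (carrier B) (y \<oplus>\<^bsub>B\<^esub> z) =
          restrict ?g (carrier B) y \<oplus>\<^bsub>A\<^esub> restrict ?g (carrier B) z"
        "restrict ?g (carrier B) (y \<otimes>\<^bsub>B\<^esub> z) =
          restrict ?g (carrier B) y \<otimes>\<^bsub>A\<^esub> restrict ?g (carrier B) z"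
        "restrict ?g (carrier B) (bracket B y z) =
          bracket A (restrict ?g (carrier B) y) (restrict ?g (carrier B) z)"
      using y z g g_closed awb_hom_closed[OF f]
      by (metis A.M.a_closed A.prod_closed A.bracket_closed restrict_apply')+
  next
    fix k y assume k: "k \<in> carrier K" and y: "y \<in> carrier B"
    have "f (k \<odot>\<^bsub>A\<^esub> ?g y) = k \<odot>\<^bsub>B\<^esub> y"
      using k y by (simp add: f_hom g_closed fg)
    then show "restrict ?g (carrier B) (k \<odot>\<^bsub>B\<^esub> y) = k \<odot>\<^bsub>A\<^esub> restrict ?g (carrier B) y"
      using k y g g_closed awb_hom_closed[OF f] by (metis A.smult_closed restrict_apply')
  qed (simp add: g_closed)
qed

lemma (in algebra_with_bracket) kernel_subalgebra:
  assumes "algebra_with_bracket K B" and f: "f \<in> awb_hom K A B"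
  shows "awb_subalgebra K {x \<in> carrier A. f x = \<zero>\<^bsub>B\<^esub>} A"
proof -
  interpret B: algebra_with_bracket K B by fact
  note zero = awb_hom_zero[OF f abelian_group_A B.abelian_group_A]
    and minus = awb_hom_minus[OF f abelian_group_A B.abelian_group_A]
  show ?thesis
    unfolding awb_subalgebra_def
    by (intro conjI submoduleI)
      (auto simp: zero minus awb_hom_add[OF f] awb_hom_mult[OF f] awb_hom_bracket[OF f]
        awb_hom_smult[OF f])
qed

lemma awb_hom_into_subalgebra:
  assumes "f \<in> awb_hom K A (sub_awb B P)" and "P \<subseteq> carrier B"
  shows "f \<in> awb_hom K A B"
  using assms by (auto simp: awb_hom_def)

section \<open>The crossed module of a cat1-algebra\<close>

definition src_kernel :: "('k, 'a) cat1 \<Rightarrow> 'a set" where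
  "src_kernel X = {x \<in> carrier (CR X). src X x = \<zero>\<^bsub>CR X\<^esub>}"

definition xmod_of_cat1 :: "('k, 'a) cat1 \<Rightarrow> ('k, 'a, 'a) xmod" where
  "xmod_of_cat1 X =
    \<lparr>XM = sub_awb (CR X) (src_kernel X), XA = sub_awb (CR X) (CP X), bdry = tgt X,
     ldot = mult (CR X), rdot = mult (CR X), lstar = bracket (CR X), rstar = bracket (CR X)\<rparr>"

text \<open>
  The kernel of \<open>s\<close> and the subalgebra \<open>P\<close> are both preserved by a morphism of cat1-algebras; the
  restrictions also make the two components extensional.
\<close>

definition xmod_of_cat1_hom :: "('k, 'a) cat1 \<Rightarrow> ('a \<Rightarrow> 'b) \<Rightarrow> ('a \<Rightarrow> 'b) \<times> ('a \<Rightarrow> 'b)" where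
  "xmod_of_cat1_hom X f = (restrict f (src_kernel X), restrict f (CP X))"

lemma xmod_of_cat1_simps [simp]:
  "XM (xmod_of_cat1 X) = sub_awb (CR X) (src_kernel X)"
  "XA (xmod_of_cat1 X) = sub_awb (CR X) (CP X)"
  "bdry (xmod_of_cat1 X) = tgt X"
  "ldot (xmod_of_cat1 X) = mult (CR X)"
  "rdot (xmod_of_cat1 X) = mult (CR X)"
  "lstar (xmod_of_cat1 X) = bracket (CR X)"
  "rstar (xmod_of_cat1 X) = bracket (CR X)"
  by (simp_all add: xmod_of_cat1_def)

locale cat1_algebra = R: algebra_with_bracket K "CR X"
  for K :: "('k, 'r) ring_scheme" and X :: "('k, 'a) cat1" +
  assumes cat1: "cat1_awb K X"
begin

lemma P_subalgebra: "awb_subalgebra K (CP X) (CR X)"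
  using cat1 by (simp add: cat1_awb_def)

lemma P_carrier: "p \<in> CP X \<Longrightarrow> p \<in> carrier (CR X)"
  using P_subalgebra R.submoduleE(1) by (auto simp: awb_subalgebra_def)

lemma src_hom: "src X \<in> awb_hom K (CR X) (CR X)"
  and tgt_hom: "tgt X \<in> awb_hom K (CR X) (CR X)"
  using cat1 P_carrier
  by (auto simp: cat1_awb_def intro: awb_hom_into_subalgebra[where P = "CP X"])

lemma src_in_P [simp]: "x \<in> carrier (CR X) \<Longrightarrow> src X x \<in> CP X"
  and tgt_in_P [simp]: "x \<in> carrier (CR X) \<Longrightarrow> tgt X x \<in> CP X"
  using cat1 by (auto simp: cat1_awb_def awb_hom_def)

lemma src_P [simp]: "p \<in> CP X \<Longrightarrow> src X p = p"
  and tgt_P [simp]: "p \<in> CP X \<Longrightarrow> tgt X p = p"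
  using cat1 by (auto simp: cat1_awb_def)

lemmas src_closed [simp, intro] = awb_hom_closed[OF src_hom]
lemmas tgt_closed [simp, intro] = awb_hom_closed[OF tgt_hom]
lemmas src_simps = awb_hom_add[OF src_hom] awb_hom_mult[OF src_hom] awb_hom_bracket[OF src_hom]
  awb_hom_smult[OF src_hom] awb_hom_zero[OF src_hom R.abelian_group_A R.abelian_group_A]
  awb_hom_minus[OF src_hom R.abelian_group_A R.abelian_group_A]
lemmas tgt_simps = awb_hom_add[OF tgt_hom] awb_hom_mult[OF tgt_hom] awb_hom_bracket[OF tgt_hom]
  awb_hom_smult[OF tgt_hom] awb_hom_zero[OF tgt_hom R.abelian_group_A R.abelian_group_A]
  awb_hom_minus[OF tgt_hom R.abelian_group_A R.abelian_group_A]

lemma src_kernel_subalgebra: "awb_subalgebra K (src_kernel X) (CR X)"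
  unfolding src_kernel_def
  using R.kernel_subalgebra[OF R.algebra_with_bracket_axioms src_hom] .

lemmas P_awb = R.subalgebra_awb[OF P_subalgebra]
lemmas src_kernel_awb = R.subalgebra_awb[OF src_kernel_subalgebra]

lemma src_kernel_carrier: "m \<in> src_kernel X \<Longrightarrow> m \<in> carrier (CR X)"
  and src_src_kernel: "m \<in> src_kernel X \<Longrightarrow> src X m = \<zero>\<^bsub>CR X\<^esub>"
  by (simp_all add: src_kernel_def)

lemma kernels_annihilate:
  assumes "x \<in> carrier (CR X)" "src X x = \<zero>\<^bsub>CR X\<^esub>" "y \<in> carrier (CR X)" "tgt X y = \<zero>\<^bsub>CR X\<^esub>"
  shows "x \<otimes>\<^bsub>CR X\<^esub> y = \<zero>\<^bsub>CR X\<^esub>" "y \<otimes>\<^bsub>CR X\<^esub> x = \<zero>\<^bsub>CR X\<^esub>"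
    and "bracket (CR X) x y = \<zero>\<^bsub>CR X\<^esub>" "bracket (CR X) y x = \<zero>\<^bsub>CR X\<^esub>"
  using cat1 assms by (auto simp: cat1_awb_def a_kernel_def')

lemma src_kernel_part: "x \<in> carrier (CR X) \<Longrightarrow> x \<ominus>\<^bsub>CR X\<^esub> src X x \<in> src_kernel X"
  by (simp add: src_kernel_def R.M.minus_eq src_simps R.M.r_neg)

lemma tgt_kernel_part: "x \<in> carrier (CR X) \<Longrightarrow> tgt X (x \<ominus>\<^bsub>CR X\<^esub> tgt X x) = \<zero>\<^bsub>CR X\<^esub>"
  by (simp add: R.M.minus_eq tgt_simps R.M.r_neg)

text \<open>
  The difference \<open>m - t m\<close> lies in the kernel of \<open>t\<close>, hence annihilates the kernel of \<open>s\<close> under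
  product and bracket on either side. Splitting one factor \<open>m\<close> as \<open>(m - t m) + t m\<close> therefore lets
  \<open>t m\<close> take its place; this yields axiom (CM2).
\<close>

lemma peiffer:
  assumes m: "m \<in> src_kernel X" and n: "n \<in> src_kernel X"
  shows "tgt X m \<otimes>\<^bsub>CR X\<^esub> n = m \<otimes>\<^bsub>CR X\<^esub> n" "m \<otimes>\<^bsub>CR X\<^esub> tgt X n = m \<otimes>\<^bsub>CR X\<^esub> n"
    and "bracket (CR X) (tgt X m) n = bracket (CR X) m n"
    and "bracket (CR X) m (tgt X n) = bracket (CR X) m n"
proof -
  have split: "x = (x \<ominus>\<^bsub>CR X\<^esub> tgt X x) \<oplus>\<^bsub>CR X\<^esub> tgt X x" if "x \<in> carrier (CR X)" for x
    using that by (simp add: R.M.minus_eq R.M.a_assoc R.M.l_neg)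
  have mn: "m \<in> carrier (CR X)" "src X m = \<zero>\<^bsub>CR X\<^esub>" "n \<in> carrier (CR X)" "src X n = \<zero>\<^bsub>CR X\<^esub>"
    using m n by (auto simp: src_kernel_def)
  note zero = kernels_annihilate[OF mn(1,2) _ tgt_kernel_part]
    kernels_annihilate[OF mn(3,4) _ tgt_kernel_part]
  have "m \<otimes>\<^bsub>CR X\<^esub> n = ((m \<ominus>\<^bsub>CR X\<^esub> tgt X m) \<oplus>\<^bsub>CR X\<^esub> tgt X m) \<otimes>\<^bsub>CR X\<^esub> n"
    using split mn by simp
  then show "tgt X m \<otimes>\<^bsub>CR X\<^esub> n = m \<otimes>\<^bsub>CR X\<^esub> n"
    using mn by (simp add: R.prod_add_left zero)
  have "m \<otimes>\<^bsub>CR X\<^esub> n = m \<otimes>\<^bsub>CR X\<^esub> ((n \<ominus>\<^bsub>CR X\<^esub> tgt X n) \<oplus>\<^bsub>CR X\<^esub> tgt X n)"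
    using split mn by simp
  then show "m \<otimes>\<^bsub>CR X\<^esub> tgt X n = m \<otimes>\<^bsub>CR X\<^esub> n"
    using mn by (simp add: R.prod_add_right zero)
  have "bracket (CR X) m n = bracket (CR X) ((m \<ominus>\<^bsub>CR X\<^esub> tgt X m) \<oplus>\<^bsub>CR X\<^esub> tgt X m) n"
    using split mn by simp
  then show "bracket (CR X) (tgt X m) n = bracket (CR X) m n"
    using mn by (simp add: R.bracket_add_left zero)
  have "bracket (CR X) m n = bracket (CR X) m ((n \<ominus>\<^bsub>CR X\<^esub> tgt X n) \<oplus>\<^bsub>CR X\<^esub> tgt X n)"
    using split mn by simp
  then show "bracket (CR X) m (tgt X n) = bracket (CR X) m n"
    using mn by (simp add: R.bracket_add_right zero)
qed

text \<open>
  The kernel of \<open>s\<close> is an ideal for the bracket as well as for the product: a bracket with a zero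
  entry vanishes by bilinearity. This is what lets \<open>P\<close> act on it.
\<close>

lemma src_kernel_absorbs:
  assumes "m \<in> src_kernel X" and "a \<in> carrier (CR X)"
  shows "a \<otimes>\<^bsub>CR X\<^esub> m \<in> src_kernel X" "m \<otimes>\<^bsub>CR X\<^esub> a \<in> src_kernel X"
    and "bracket (CR X) a m \<in> src_kernel X" "bracket (CR X) m a \<in> src_kernel X"
  using assms by (auto simp: src_kernel_def src_simps)

text \<open>
  With all four action maps given by operations of \<open>R\<close>, each action axiom is an instance of
  associativity or of the bracket identity in \<open>R\<close>, up to the order of the two summands.
\<close>

lemma action_on_src_kernel:
  "awb_action K (sub_awb (CR X) (CP X)) (sub_awb (CR X) (src_kernel X))
    (mult (CR X)) (mult (CR X)) (bracket (CR X)) (bracket (CR X))"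
proof -
  interpret P: algebra_with_bracket K "sub_awb (CR X) (CP X)" by (rule P_awb)
  interpret N: algebra_with_bracket K "sub_awb (CR X) (src_kernel X)" by (rule src_kernel_awb)
  note carriers = P_carrier src_kernel_carrier
  note bil = bilinear_map_restrict[OF R.mult_bilinear] bilinear_map_restrict[OF R.bracket_bilinear]
  have "bilinear_map K (sub_awb (CR X) (CP X)) (sub_awb (CR X) (src_kernel X))
        (sub_awb (CR X) (src_kernel X)) b"
    and "bilinear_map K (sub_awb (CR X) (src_kernel X)) (sub_awb (CR X) (CP X))
        (sub_awb (CR X) (src_kernel X)) b"
    if "b = mult (CR X) \<or> b = bracket (CR X)" for b
    using that carriers src_kernel_absorbs by (auto intro!: bil)
  then show ?thesis
    by (intro awb_action.intro P_awb src_kernel_awb awb_action_axioms.intro)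
      (simp_all add: carriers R.mult_assoc R.bracket_mult R.M.a_comm)
qed

lemma crossed_module_xmod_of_cat1: "crossed_module K (xmod_of_cat1 X)"
proof -
  have "tgt X \<in> awb_hom K (sub_awb (CR X) (src_kernel X)) (sub_awb (CR X) (CP X))"
    by (intro awb_homI) (auto simp: src_kernel_carrier tgt_simps)
  then show ?thesis
    using action_on_src_kernel
    by (auto simp: crossed_module_def peiffer src_kernel_carrier P_carrier tgt_simps)
qed

end

lemma cat1_algebraI: "cat1_awb K X \<Longrightarrow> cat1_algebra K X"
  by (simp add: cat1_algebra_def cat1_algebra_axioms_def cat1_awb_def)

lemma cat1_homD:
  assumes "f \<in> cat1_hom K X Y"
  shows "f \<in> awb_hom K (CR X) (CR Y)" "f \<in> extensional (carrier (CR X))"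
    and "p \<in> CP X \<Longrightarrow> f p \<in> CP Y"
    and "x \<in> carrier (CR X) \<Longrightarrow> src Y (f x) = f (src X x)"
    and "x \<in> carrier (CR X) \<Longrightarrow> tgt Y (f x) = f (tgt X x)"
  using assms by (auto simp: cat1_hom_def)

lemma xmod_of_cat1_hom_in_xmod_hom:
  assumes "cat1_awb K X" "cat1_awb K Y" and f: "f \<in> cat1_hom K X Y"
  shows "xmod_of_cat1_hom X f \<in> xmod_hom K (xmod_of_cat1 X) (xmod_of_cat1 Y)"
proof -
  interpret X: cat1_algebra K X using assms(1) by (rule cat1_algebraI)
  interpret Y: cat1_algebra K Y using assms(2) by (rule cat1_algebraI)
  note f = cat1_homD[OF f]
  note f_hom = awb_hom_add[OF f(1)] awb_hom_mult[OF f(1)] awb_hom_bracket[OF f(1)]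
    awb_hom_closed[OF f(1)] awb_hom_zero[OF f(1) X.R.abelian_group_A Y.R.abelian_group_A]
  have ker: "f m \<in> src_kernel Y" if "m \<in> src_kernel X" for m
    using that f by (auto simp: src_kernel_def f_hom)
  have "restrict f (src_kernel X)
      \<in> awb_hom K (sub_awb (CR X) (src_kernel X)) (sub_awb (CR Y) (src_kernel Y))"
    using X.src_kernel_carrier ker
    by (intro awb_hom_restrict_subalgebra[OF f(1) _ X.src_kernel_awb]) auto
  moreover have "restrict f (CP X) \<in> awb_hom K (sub_awb (CR X) (CP X)) (sub_awb (CR Y) (CP Y))"
    using X.P_carrier f(3)
    by (intro awb_hom_restrict_subalgebra[OF f(1) _ X.P_awb]) auto
  ultimately show ?thesis
    by (auto simp: xmod_hom_def xmod_of_cat1_hom_def X.src_kernel_carrier X.P_carrier f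
        X.src_kernel_absorbs f_hom)
qed

section \<open>The semidirect product of an action\<close>

text \<open>
  The name \<open>inv\<close> denotes inversion in a group here, so the inverse of the coding map is written with
  \<open>inv_into\<close>.
\<close>

abbreviation decode :: "('b \<Rightarrow> 'c) \<Rightarrow> 'c \<Rightarrow> 'b" where
  "decode enc \<equiv> inv_into UNIV enc"

text \<open>
  The semidirect product \<open>M \<rtimes> A\<close> on coded pairs. Product and bracket are what distributing
  \<open>(m + a)(n + b)\<close> and \<open>[m + a, n + b]\<close> would give, with the mixed terms supplied by the action. The
  coding map \<open>enc\<close> lets the result share the type of \<open>M\<close> and \<open>A\<close>; for the identity one gets the
  product on genuine pairs.
\<close>

definition semidirect_awb :: "('m \<times> 'a \<Rightarrow> 'c) \<Rightarrow> ('k, 'm, 'a) xmod \<Rightarrow> ('k, 'c) awb" where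
  "semidirect_awb enc X =
    \<lparr>carrier = enc ` (carrier (XM X) \<times> carrier (XA X)),
     mult = (\<lambda>x y. case (decode enc x, decode enc y) of ((m, a), (n, b)) \<Rightarrow>
       enc (m \<otimes>\<^bsub>XM X\<^esub> n \<oplus>\<^bsub>XM X\<^esub> ldot X a n \<oplus>\<^bsub>XM X\<^esub> rdot X m b, a \<otimes>\<^bsub>XA X\<^esub> b)),
     one = undefined,
     zero = enc (\<zero>\<^bsub>XM X\<^esub>, \<zero>\<^bsub>XA X\<^esub>),
     add = (\<lambda>x y. case (decode enc x, decode enc y) of ((m, a), (n, b)) \<Rightarrow>
       enc (m \<oplus>\<^bsub>XM X\<^esub> n, a \<oplus>\<^bsub>XA X\<^esub> b)),
     smult = (\<lambda>k x. case decode enc x of (m, a) \<Rightarrow> enc (k \<odot>\<^bsub>XM X\<^esub> m, k \<odot>\<^bsub>XA X\<^esub> a)),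
     bracket = (\<lambda>x y. case (decode enc x, decode enc y) of ((m, a), (n, b)) \<Rightarrow>
       enc (bracket (XM X) m n \<oplus>\<^bsub>XM X\<^esub> lstar X a n \<oplus>\<^bsub>XM X\<^esub> rstar X m b, bracket (XA X) a b))\<rparr>"

locale coded_action =
  awb_action K "XA X" "XM X" "ldot X" "rdot X" "lstar X" "rstar X"
  for K :: "('k, 'r) ring_scheme" and X :: "('k, 'm, 'a) xmod" +
  fixes enc :: "'m \<times> 'a \<Rightarrow> 'c"
  assumes inj_enc: "inj enc"
begin

abbreviation "S \<equiv> semidirect_awb enc X"

lemma enc_eq [simp]: "enc p = enc q \<longleftrightarrow> p = q"
  using inj_enc by (rule inj_eq)

lemma decode_enc [simp]: "decode enc (enc p) = p"
  using inj_enc by simp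

lemma enc_in_image [simp]: "enc p \<in> enc ` B \<longleftrightarrow> p \<in> B"
  by auto

lemma semidirect_simps [simp]:
  "carrier S = enc ` (carrier (XM X) \<times> carrier (XA X))"
  "\<zero>\<^bsub>S\<^esub> = enc (\<zero>\<^bsub>XM X\<^esub>, \<zero>\<^bsub>XA X\<^esub>)"
  "enc (m, a) \<oplus>\<^bsub>S\<^esub> enc (n, b) = enc (m \<oplus>\<^bsub>XM X\<^esub> n, a \<oplus>\<^bsub>XA X\<^esub> b)"
  "k \<odot>\<^bsub>S\<^esub> enc (m, a) = enc (k \<odot>\<^bsub>XM X\<^esub> m, k \<odot>\<^bsub>XA X\<^esub> a)"
  "enc (m, a) \<otimes>\<^bsub>S\<^esub> enc (n, b) =
    enc (m \<otimes>\<^bsub>XM X\<^esub> n \<oplus>\<^bsub>XM X\<^esub> ldot X a n \<oplus>\<^bsub>XM X\<^esub> rdot X m b, a \<otimes>\<^bsub>XA X\<^esub> b)"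
  "bracket S (enc (m, a)) (enc (n, b)) =
    enc (bracket (XM X) m n \<oplus>\<^bsub>XM X\<^esub> lstar X a n \<oplus>\<^bsub>XM X\<^esub> rstar X m b, bracket (XA X) a b)"
  by (simp_all add: semidirect_awb_def)

lemmas act_closed [simp, intro] =
  bilinear_closed[OF ld_bilinear] bilinear_closed[OF rd_bilinear]
  bilinear_closed[OF ls_bilinear] bilinear_closed[OF rs_bilinear]

lemmas act_linear =
  bilinear_add_left[OF ld_bilinear] bilinear_add_left[OF rd_bilinear]
  bilinear_add_left[OF ls_bilinear] bilinear_add_left[OF rs_bilinear]
  bilinear_add_right[OF ld_bilinear] bilinear_add_right[OF rd_bilinear]
  bilinear_add_right[OF ls_bilinear] bilinear_add_right[OF rs_bilinear]
  bilinear_smult_left[OF ld_bilinear] bilinear_smult_left[OF rd_bilinear]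
  bilinear_smult_left[OF ls_bilinear] bilinear_smult_left[OF rs_bilinear]
  bilinear_smult_right[OF ld_bilinear] bilinear_smult_right[OF rd_bilinear]
  bilinear_smult_right[OF ls_bilinear] bilinear_smult_right[OF rs_bilinear]

lemmas act_zero [simp] =
  bilinear_zero_left[OF ld_bilinear A.abelian_group_A M.abelian_group_A]
  bilinear_zero_left[OF rd_bilinear M.abelian_group_A M.abelian_group_A]
  bilinear_zero_left[OF ls_bilinear A.abelian_group_A M.abelian_group_A]
  bilinear_zero_left[OF rs_bilinear M.abelian_group_A M.abelian_group_A]
  bilinear_zero_right[OF ld_bilinear M.abelian_group_A M.abelian_group_A]
  bilinear_zero_right[OF rd_bilinear A.abelian_group_A M.abelian_group_A]
  bilinear_zero_right[OF ls_bilinear M.abelian_group_A M.abelian_group_A]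
  bilinear_zero_right[OF rs_bilinear A.abelian_group_A M.abelian_group_A]

lemma semidirect_module: "module K S"
proof (rule moduleI)
  show "abelian_group S"
  proof (rule abelian_groupI)
    fix x assume "x \<in> carrier S"
    then obtain m a where x: "x = enc (m, a)" "m \<in> carrier (XM X)" "a \<in> carrier (XA X)"
      by auto
    then have "enc (\<ominus>\<^bsub>XM X\<^esub> m, \<ominus>\<^bsub>XA X\<^esub> a) \<oplus>\<^bsub>S\<^esub> x = \<zero>\<^bsub>S\<^esub>"
      by (simp add: A.M.l_neg M.M.l_neg)
    then show "\<exists>y \<in> carrier S. y \<oplus>\<^bsub>S\<^esub> x = \<zero>\<^bsub>S\<^esub>"
      using x by force
  qed (auto simp: A.M.a_ac M.M.a_ac)
qed (auto simp: A.linear_simps M.linear_simps A.smult_assoc1 M.smult_assoc1 intro: A.is_cring)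

lemma semidirect_bilinear:
  "bilinear_map K S S S (mult S)" "bilinear_map K S S S (bracket S)"
  by (auto simp: bilinear_map_def A.linear_simps M.linear_simps act_linear M.add_ac)

text \<open>
  After distribution the \<open>M\<close>-component splits according to which of the three factors come from \<open>M\<close>;
  the six mixed cases are the six action axioms that do not involve the bracket.
\<close>

lemma semidirect_assoc:
  assumes "x \<in> carrier S" "y \<in> carrier S" "z \<in> carrier S"
  shows "(x \<otimes>\<^bsub>S\<^esub> y) \<otimes>\<^bsub>S\<^esub> z = x \<otimes>\<^bsub>S\<^esub> (y \<otimes>\<^bsub>S\<^esub> z)"
  using assms
  by (auto simp: M.linear_simps act_linear A.mult_assoc M.mult_assoc
      ld_mult rd_mult ld_rd mult_rd ld_mult_M rd_mult_ld M.add_ac)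

text \<open>
  Again by cases on which factors come from \<open>M\<close>: the six mixed cases are the six action axioms
  that involve the bracket.
\<close>

lemma semidirect_bracket_mult:
  assumes "x \<in> carrier S" "y \<in> carrier S" "z \<in> carrier S"
  shows "bracket S (x \<otimes>\<^bsub>S\<^esub> y) z = (bracket S x z \<otimes>\<^bsub>S\<^esub> y) \<oplus>\<^bsub>S\<^esub> (x \<otimes>\<^bsub>S\<^esub> bracket S y z)"
  using assms
  by (auto simp: M.linear_simps act_linear A.bracket_mult M.bracket_mult
      rs_ld rs_rd ls_mult bracket_rd bracket_ld mult_rs M.add_ac)

lemma semidirect_algebra: "algebra_with_bracket K S"
  by (intro algebra_with_bracket.intro algebra_with_bracket_axioms.intro A.field_axioms
      semidirect_module semidirect_bilinear semidirect_assoc semidirect_bracket_mult)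

end

section \<open>The cat1-algebra of a crossed module\<close>

text \<open>
  The base \<open>{0} \<times> A\<close> is a copy of \<open>A\<close>. Regarding \<open>(m, a)\<close> as an arrow from \<open>a\<close> to \<open>\<mu> m + a\<close> explains
  the source and target maps.
\<close>

definition cat1_of_xmod :: "('m \<times> 'a \<Rightarrow> 'c) \<Rightarrow> ('k, 'm, 'a) xmod \<Rightarrow> ('k, 'c) cat1" where
  "cat1_of_xmod enc X =
    \<lparr>CR = semidirect_awb enc X,
     CP = enc ` ({\<zero>\<^bsub>XM X\<^esub>} \<times> carrier (XA X)),
     src = (\<lambda>x. enc (\<zero>\<^bsub>XM X\<^esub>, snd (decode enc x))),
     tgt = (\<lambda>x. enc (\<zero>\<^bsub>XM X\<^esub>, bdry X (fst (decode enc x)) \<oplus>\<^bsub>XA X\<^esub> snd (decode enc x)))\<rparr>"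

definition cat1_of_xmod_hom ::
    "('m \<times> 'a \<Rightarrow> 'c) \<Rightarrow> ('n \<times> 'b \<Rightarrow> 'd) \<Rightarrow> ('k, 'm, 'a) xmod
      \<Rightarrow> ('m \<Rightarrow> 'n) \<times> ('a \<Rightarrow> 'b) \<Rightarrow> ('c \<Rightarrow> 'd)" where
  "cat1_of_xmod_hom enc enc' X f =
    restrict (\<lambda>x. enc' (map_prod (fst f) (snd f) (decode enc x)))
      (carrier (semidirect_awb enc X))"

lemma crossed_moduleD:
  assumes "crossed_module K X"
  shows "awb_action K (XA X) (XM X) (ldot X) (rdot X) (lstar X) (rstar X)"
    and "bdry X \<in> awb_hom K (XM X) (XA X)"
    and "\<lbrakk>m \<in> carrier (XM X); a \<in> carrier (XA X)\<rbrakk>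
      \<Longrightarrow> bdry X (rdot X m a) = bdry X m \<otimes>\<^bsub>XA X\<^esub> a"
    and "\<lbrakk>m \<in> carrier (XM X); a \<in> carrier (XA X)\<rbrakk>
      \<Longrightarrow> bdry X (ldot X a m) = a \<otimes>\<^bsub>XA X\<^esub> bdry X m"
    and "\<lbrakk>m \<in> carrier (XM X); a \<in> carrier (XA X)\<rbrakk>
      \<Longrightarrow> bdry X (rstar X m a) = bracket (XA X) (bdry X m) a"
    and "\<lbrakk>m \<in> carrier (XM X); a \<in> carrier (XA X)\<rbrakk>
      \<Longrightarrow> bdry X (lstar X a m) = bracket (XA X) a (bdry X m)"
    and "\<lbrakk>m \<in> carrier (XM X); n \<in> carrier (XM X)\<rbrakk> \<Longrightarrow> ldot X (bdry X m) n = m \<otimes>\<^bsub>XM X\<^esub> n"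
    and "\<lbrakk>m \<in> carrier (XM X); n \<in> carrier (XM X)\<rbrakk> \<Longrightarrow> rdot X m (bdry X n) = m \<otimes>\<^bsub>XM X\<^esub> n"
    and "\<lbrakk>m \<in> carrier (XM X); n \<in> carrier (XM X)\<rbrakk> \<Longrightarrow> lstar X (bdry X m) n = bracket (XM X) m n"
    and "\<lbrakk>m \<in> carrier (XM X); n \<in> carrier (XM X)\<rbrakk> \<Longrightarrow> rstar X m (bdry X n) = bracket (XM X) m n"
  using assms by (simp_all add: crossed_module_def)

locale coded_crossed_module = coded_action +
  assumes crossed: "crossed_module K X"
begin

lemmas bdry_hom = crossed_moduleD(2)[OF crossed]
lemmas bdry_closed [simp, intro] = awb_hom_closed[OF bdry_hom]
lemmas bdry_zero [simp] = awb_hom_zero[OF bdry_hom M.abelian_group_A A.abelian_group_A]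
lemmas bdry_simps =
  awb_hom_add[OF bdry_hom] awb_hom_mult[OF bdry_hom] awb_hom_bracket[OF bdry_hom]
  awb_hom_smult[OF bdry_hom] crossed_moduleD(3-6)[OF crossed]

abbreviation "C \<equiv> cat1_of_xmod enc X"

lemma cat1_of_xmod_simps [simp]:
  "CR C = S"
  "CP C = enc ` ({\<zero>\<^bsub>XM X\<^esub>} \<times> carrier (XA X))"
  "src C (enc (m, a)) = enc (\<zero>\<^bsub>XM X\<^esub>, a)"
  "tgt C (enc (m, a)) = enc (\<zero>\<^bsub>XM X\<^esub>, bdry X m \<oplus>\<^bsub>XA X\<^esub> a)"
  by (simp_all add: cat1_of_xmod_def)

lemma base_subalgebra: "awb_subalgebra K (CP C) S"
proof -
  interpret S: algebra_with_bracket K S by (rule semidirect_algebra)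
  have neg: "\<ominus>\<^bsub>S\<^esub> enc (\<zero>\<^bsub>XM X\<^esub>, a) = enc (\<zero>\<^bsub>XM X\<^esub>, \<ominus>\<^bsub>XA X\<^esub> a)" if "a \<in> carrier (XA X)" for a
    using that by (intro S.M.minus_equality) (auto simp: A.M.l_neg)
  show ?thesis
    unfolding awb_subalgebra_def
    by (intro conjI S.submoduleI) (auto simp: neg)
qed

text \<open>
  The left-hand sides are the \<open>M\<close>-components of the products and brackets of \<open>(m, 0)\<close>, a general
  element of the kernel of \<open>s\<close>, with \<open>(n, a)\<close>, a general element of the kernel of \<open>t\<close>. Axiom (CM2)
  turns \<open>m n\<close> into \<open>m \<cdot> \<mu> n\<close>, so that the two summands combine to \<open>m \<cdot> (\<mu> n + a) = m \<cdot> 0\<close>.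
\<close>

lemma tgt_kernel_annihilates:
  assumes m: "m \<in> carrier (XM X)" and n: "n \<in> carrier (XM X)" and a: "a \<in> carrier (XA X)"
    and zero: "bdry X n \<oplus>\<^bsub>XA X\<^esub> a = \<zero>\<^bsub>XA X\<^esub>"
  shows "m \<otimes>\<^bsub>XM X\<^esub> n \<oplus>\<^bsub>XM X\<^esub> rdot X m a = \<zero>\<^bsub>XM X\<^esub>"
    and "n \<otimes>\<^bsub>XM X\<^esub> m \<oplus>\<^bsub>XM X\<^esub> ldot X a m = \<zero>\<^bsub>XM X\<^esub>"
    and "bracket (XM X) m n \<oplus>\<^bsub>XM X\<^esub> rstar X m a = \<zero>\<^bsub>XM X\<^esub>"
    and "bracket (XM X) n m \<oplus>\<^bsub>XM X\<^esub> lstar X a m = \<zero>\<^bsub>XM X\<^esub>"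
proof -
  note cm = crossed_moduleD(7-10)[OF crossed, symmetric]
  show "m \<otimes>\<^bsub>XM X\<^esub> n \<oplus>\<^bsub>XM X\<^esub> rdot X m a = \<zero>\<^bsub>XM X\<^esub>"
    using bilinear_add_right[OF rd_bilinear m bdry_closed[OF n] a] m n
    by (simp add: zero cm(2))
  show "n \<otimes>\<^bsub>XM X\<^esub> m \<oplus>\<^bsub>XM X\<^esub> ldot X a m = \<zero>\<^bsub>XM X\<^esub>"
    using bilinear_add_left[OF ld_bilinear bdry_closed[OF n] a m] m n
    by (simp add: zero cm(1))
  show "bracket (XM X) m n \<oplus>\<^bsub>XM X\<^esub> rstar X m a = \<zero>\<^bsub>XM X\<^esub>"
    using bilinear_add_right[OF rs_bilinear m bdry_closed[OF n] a] m n
    by (simp add: zero cm(4))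
  show "bracket (XM X) n m \<oplus>\<^bsub>XM X\<^esub> lstar X a m = \<zero>\<^bsub>XM X\<^esub>"
    using bilinear_add_left[OF ls_bilinear bdry_closed[OF n] a m] m n
    by (simp add: zero cm(3))
qed

lemma cat1_awb_cat1_of_xmod: "cat1_awb K C"
proof -
  have "src C \<in> awb_hom K S (sub_awb S (CP C))"
    by (intro awb_homI) auto
  moreover have "tgt C \<in> awb_hom K S (sub_awb S (CP C))"
    by (intro awb_homI)
      (auto simp: bdry_simps A.linear_simps A.add_ac)
  ultimately show ?thesis
    unfolding cat1_awb_def
    using semidirect_algebra base_subalgebra
    by (auto simp: a_kernel_def' tgt_kernel_annihilates)
qed

end

lemma coded_crossed_moduleI:
  "\<lbrakk>crossed_module K X; inj enc\<rbrakk> \<Longrightarrow> coded_crossed_module K X enc"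
  by (simp add: coded_crossed_module_def coded_crossed_module_axioms_def coded_action_def
      coded_action_axioms_def crossed_moduleD(1))

lemma xmod_homD:
  assumes "f \<in> xmod_hom K X Y"
  shows "fst f \<in> awb_hom K (XM X) (XM Y)" "fst f \<in> extensional (carrier (XM X))"
    and "snd f \<in> awb_hom K (XA X) (XA Y)" "snd f \<in> extensional (carrier (XA X))"
    and "m \<in> carrier (XM X) \<Longrightarrow> snd f (bdry X m) = bdry Y (fst f m)"
    and "\<lbrakk>a \<in> carrier (XA X); m \<in> carrier (XM X)\<rbrakk>
      \<Longrightarrow> fst f (ldot X a m) = ldot Y (snd f a) (fst f m)"
    and "\<lbrakk>a \<in> carrier (XA X); m \<in> carrier (XM X)\<rbrakk>
      \<Longrightarrow> fst f (rdot X m a) = rdot Y (fst f m) (snd f a)"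
    and "\<lbrakk>a \<in> carrier (XA X); m \<in> carrier (XM X)\<rbrakk>
      \<Longrightarrow> fst f (lstar X a m) = lstar Y (snd f a) (fst f m)"
    and "\<lbrakk>a \<in> carrier (XA X); m \<in> carrier (XM X)\<rbrakk>
      \<Longrightarrow> fst f (rstar X m a) = rstar Y (fst f m) (snd f a)"
  using assms by (auto simp: xmod_hom_def)

lemma cat1_of_xmod_hom_in_cat1_hom:
  assumes "crossed_module K X" "crossed_module K Y" "inj enc" "inj enc'"
    and f: "f \<in> xmod_hom K X Y"
  shows "cat1_of_xmod_hom enc enc' X f \<in> cat1_hom K (cat1_of_xmod enc X) (cat1_of_xmod enc' Y)"
proof -
  interpret X: coded_crossed_module K X enc using assms by (intro coded_crossed_moduleI)
  interpret Y: coded_crossed_module K Y enc' using assms by (intro coded_crossed_moduleI)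
  note f = xmod_homD[OF f]
  note f_hom = awb_hom_closed[OF f(1)] awb_hom_closed[OF f(3)] awb_hom_add[OF f(1)]
    awb_hom_add[OF f(3)] awb_hom_mult[OF f(1)] awb_hom_mult[OF f(3)]
    awb_hom_bracket[OF f(1)] awb_hom_bracket[OF f(3)] awb_hom_smult[OF f(1)]
    awb_hom_smult[OF f(3)] f(5-9)
    awb_hom_zero[OF f(1) X.M.abelian_group_A Y.M.abelian_group_A]
  have apply_enc: "cat1_of_xmod_hom enc enc' X f (enc (m, a)) = enc' (fst f m, snd f a)"
    if "m \<in> carrier (XM X)" "a \<in> carrier (XA X)" for m a
    using that by (simp add: cat1_of_xmod_hom_def)
  have "cat1_of_xmod_hom enc enc' X f \<in> awb_hom K X.S Y.S"
    by (intro awb_homI) (auto simp: apply_enc f_hom)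
  then show ?thesis
    unfolding cat1_hom_def
    by (auto simp: apply_enc f_hom) (simp add: cat1_of_xmod_hom_def)
qed

section \<open>The two categories and the two functors\<close>

lemma cat1_cat_simps [simp]:
  "Ob (cat1_cat K) = {X. cat1_awb K X}"
  "Hom (cat1_cat K) = cat1_hom K"
  "Ident (cat1_cat K) X = restrict (\<lambda>x. x) (carrier (CR X))"
  "Comp (cat1_cat K) X Y Z g f = compose (carrier (CR X)) g f"
  by (simp_all add: cat1_cat_def)

lemma xmod_cat_simps [simp]:
  "Ob (xmod_cat K) = {X. crossed_module K X}"
  "Hom (xmod_cat K) = xmod_hom K"
  "Ident (xmod_cat K) X =
    (restrict (\<lambda>m. m) (carrier (XM X)), restrict (\<lambda>a. a) (carrier (XA X)))"
  "Comp (xmod_cat K) X Y Z g f =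
    (compose (carrier (XM X)) (fst g) (fst f), compose (carrier (XA X)) (snd g) (snd f))"
  by (simp_all add: xmod_cat_def)

lemma category_cat1_cat: "category (cat1_cat K :: (('k, 'u) cat1, 'u \<Rightarrow> 'u) cat)"
proof
  fix X :: "('k, 'u) cat1" assume "X \<in> Ob (cat1_cat K)"
  then interpret X: cat1_algebra K X by (simp add: cat1_algebraI)
  show "Ident (cat1_cat K) X \<in> Hom (cat1_cat K) X X"
    using awb_hom_identity[OF X.R.algebra_with_bracket_axioms]
    by (auto simp: cat1_hom_def X.P_carrier)
next
  fix X Y Z :: "('k, 'u) cat1" and f g
  assume "X \<in> Ob (cat1_cat K)" and f: "f \<in> Hom (cat1_cat K) X Y" and g: "g \<in> Hom (cat1_cat K) Y Z"
  then interpret X: cat1_algebra K X by (simp add: cat1_algebraI)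
  have f: "f \<in> cat1_hom K X Y" and g: "g \<in> cat1_hom K Y Z" using f g by simp_all
  note homs = cat1_homD(1)[OF f] cat1_homD(1)[OF g]
  show "Comp (cat1_cat K) X Y Z g f \<in> Hom (cat1_cat K) X Z"
    using awb_hom_compose[OF X.R.algebra_with_bracket_axioms homs]
    by (auto simp: cat1_hom_def compose_eq X.P_carrier cat1_homD[OF f] cat1_homD[OF g]
        awb_hom_closed[OF homs(1)])
next
  fix X Y :: "('k, 'u) cat1" and f
  assume "f \<in> Hom (cat1_cat K) X Y"
  then have "f \<in> carrier (CR X) \<rightarrow> carrier (CR Y)" "f \<in> extensional (carrier (CR X))"
    by (auto simp: cat1_hom_def awb_hom_def)
  then show "Comp (cat1_cat K) X Y Y (Ident (cat1_cat K) Y) f = f"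
    "Comp (cat1_cat K) X X Y f (Ident (cat1_cat K) X) = f"
    by (simp_all add: Id_compose compose_Id)
next
  fix W X Y Z :: "('k, 'u) cat1" and f g h
  assume "f \<in> Hom (cat1_cat K) W X"
  then have "f \<in> carrier (CR W) \<rightarrow> carrier (CR X)"
    by (auto simp: cat1_hom_def awb_hom_def)
  then show "Comp (cat1_cat K) W Y Z h (Comp (cat1_cat K) W X Y g f) =
      Comp (cat1_cat K) W X Z (Comp (cat1_cat K) X Y Z h g) f"
    by (simp add: compose_assoc)
qed

lemma category_xmod_cat:
  "category (xmod_cat K :: (('k, 'u, 'u) xmod, ('u \<Rightarrow> 'u) \<times> ('u \<Rightarrow> 'u)) cat)"
proof
  fix X :: "('k, 'u, 'u) xmod" assume "X \<in> Ob (xmod_cat K)"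
  \<comment> \<open>Only facts about the action and the boundary are wanted, so any coding of pairs will do.\<close>
  then interpret X: coded_crossed_module K X "\<lambda>p. p" by (simp add: coded_crossed_moduleI)
  show "Ident (xmod_cat K) X \<in> Hom (xmod_cat K) X X"
    using awb_hom_identity[OF X.A.algebra_with_bracket_axioms]
      awb_hom_identity[OF X.M.algebra_with_bracket_axioms]
    by (auto simp: xmod_hom_def)
next
  fix X Y Z :: "('k, 'u, 'u) xmod" and f g
  assume "X \<in> Ob (xmod_cat K)" and f: "f \<in> Hom (xmod_cat K) X Y" and g: "g \<in> Hom (xmod_cat K) Y Z"
  then interpret X: coded_crossed_module K X "\<lambda>p. p" by (simp add: coded_crossed_moduleI)
  have f: "f \<in> xmod_hom K X Y" and g: "g \<in> xmod_hom K Y Z" using f g by simp_all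
  note f = xmod_homD[OF f] and g = xmod_homD[OF g]
  show "Comp (xmod_cat K) X Y Z g f \<in> Hom (xmod_cat K) X Z"
    using awb_hom_compose[OF X.M.algebra_with_bracket_axioms f(1) g(1)]
      awb_hom_compose[OF X.A.algebra_with_bracket_axioms f(3) g(3)]
    by (auto simp: xmod_hom_def compose_eq f(5-) g(5-) awb_hom_closed[OF f(1)]
        awb_hom_closed[OF f(3)])
next
  fix X Y :: "('k, 'u, 'u) xmod" and f
  assume "f \<in> Hom (xmod_cat K) X Y"
  then have "fst f \<in> carrier (XM X) \<rightarrow> carrier (XM Y)" "fst f \<in> extensional (carrier (XM X))"
    "snd f \<in> carrier (XA X) \<rightarrow> carrier (XA Y)" "snd f \<in> extensional (carrier (XA X))"
    by (auto simp: xmod_hom_def awb_hom_def)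
  then show "Comp (xmod_cat K) X Y Y (Ident (xmod_cat K) Y) f = f"
    "Comp (xmod_cat K) X X Y f (Ident (xmod_cat K) X) = f"
    by (simp_all add: Id_compose compose_Id)
next
  fix W X Y Z :: "('k, 'u, 'u) xmod" and f g h
  assume "f \<in> Hom (xmod_cat K) W X"
  then have "fst f \<in> carrier (XM W) \<rightarrow> carrier (XM X)" "snd f \<in> carrier (XA W) \<rightarrow> carrier (XA X)"
    by (auto simp: xmod_hom_def awb_hom_def)
  then show "Comp (xmod_cat K) W Y Z h (Comp (xmod_cat K) W X Y g f) =
      Comp (xmod_cat K) W X Z (Comp (xmod_cat K) X Y Z h g) f"
    by (simp add: compose_assoc)
qed

text \<open>
  An inverse of \<open>f\<close> maps the base of \<open>Y\<close> into that of \<open>X\<close> because the base is the set of fixed points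
  of the source map, which the inverse respects.
\<close>

lemma cat1_iso_if_bij:
  assumes X: "cat1_awb K X" and Y: "cat1_awb K Y" and f: "f \<in> cat1_hom K X Y"
    and bij: "bij_betw f (carrier (CR X)) (carrier (CR Y))"
  shows "is_iso (cat1_cat K) X Y f"
proof -
  interpret X: cat1_algebra K X using X by (rule cat1_algebraI)
  interpret Y: cat1_algebra K Y using Y by (rule cat1_algebraI)
  let ?g = "restrict (inv_into (carrier (CR X)) f) (carrier (CR Y))"
  have gf: "inv_into (carrier (CR X)) f (f x) = x" if "x \<in> carrier (CR X)" for x
    using that bij by (simp add: bij_betw_def)
  have g_closed: "inv_into (carrier (CR X)) f y \<in> carrier (CR X)"
    and fg: "f (inv_into (carrier (CR X)) f y) = y" if "y \<in> carrier (CR Y)" for y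
    using that bij by (auto simp: bij_betw_def inv_into_into f_inv_into_f)
  note f' = cat1_homD[OF f]
  have g_src: "inv_into (carrier (CR X)) f (src Y y) = src X (inv_into (carrier (CR X)) f y)"
    and g_tgt: "inv_into (carrier (CR X)) f (tgt Y y) = tgt X (inv_into (carrier (CR X)) f y)"
    if "y \<in> carrier (CR Y)" for y
    using that f'(4,5)[of "inv_into (carrier (CR X)) f y"]
      gf[of "src X (inv_into (carrier (CR X)) f y)"] gf[of "tgt X (inv_into (carrier (CR X)) f y)"]
    by (simp_all add: g_closed fg)
  have g_P: "inv_into (carrier (CR X)) f p \<in> CP X" if "p \<in> CP Y" for p
    using g_src[of p] X.src_in_P[of "inv_into (carrier (CR X)) f p"] that
    by (simp add: Y.P_carrier g_closed)
  have "?g \<in> cat1_hom K Y X"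
    using awb_hom_inverse[OF X.R.algebra_with_bracket_axioms f'(1) bij]
    by (auto simp: cat1_hom_def g_src g_tgt g_P Y.P_carrier)
  moreover have "compose (carrier (CR X)) ?g f = restrict (\<lambda>x. x) (carrier (CR X))"
    "compose (carrier (CR Y)) f ?g = restrict (\<lambda>x. x) (carrier (CR Y))"
    using awb_hom_closed[OF f'(1)] by (auto simp: compose_def gf fg intro!: restrict_ext)
  ultimately show ?thesis
    using f by (auto simp: is_iso_def)
qed

lemma xmod_iso_if_bij:
  assumes X: "crossed_module K X" and Y: "crossed_module K Y" and f: "f \<in> xmod_hom K X Y"
    and bij1: "bij_betw (fst f) (carrier (XM X)) (carrier (XM Y))"
    and bij2: "bij_betw (snd f) (carrier (XA X)) (carrier (XA Y))"
  shows "is_iso (xmod_cat K) X Y f"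
proof -
  interpret X: coded_crossed_module K X "\<lambda>p. p" using X by (simp add: coded_crossed_moduleI)
  interpret Y: coded_crossed_module K Y "\<lambda>p. p" using Y by (simp add: coded_crossed_moduleI)
  let ?g = "inv_into (carrier (XM X)) (fst f)" and ?h = "inv_into (carrier (XA X)) (snd f)"
  let ?gh = "(restrict ?g (carrier (XM Y)), restrict ?h (carrier (XA Y)))"
  note f' = xmod_homD[OF f]
  note f_closed = awb_hom_closed[OF f'(1)] awb_hom_closed[OF f'(3)]
  have M: "\<exists>m' \<in> carrier (XM X). m = fst f m'" if "m \<in> carrier (XM Y)" for m
    using that bij1 by (auto simp: bij_betw_def)
  have A: "\<exists>a' \<in> carrier (XA X). a = snd f a'" if "a \<in> carrier (XA Y)" for a
    using that bij2 by (auto simp: bij_betw_def)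
  have inv1: "?g (fst f m) = m" if "m \<in> carrier (XM X)" for m
    using that bij1 by (simp add: bij_betw_def)
  have inv2: "?h (snd f a) = a" if "a \<in> carrier (XA X)" for a
    using that bij2 by (simp add: bij_betw_def)
  have "?h (bdry Y m) = bdry X (?g m)" if "m \<in> carrier (XM Y)" for m
    using M[OF that] by (auto simp: inv1 inv2 f'(5)[symmetric])
  moreover have "?g (ldot Y a m) = ldot X (?h a) (?g m)" "?g (rdot Y m a) = rdot X (?g m) (?h a)"
    "?g (lstar Y a m) = lstar X (?h a) (?g m)" "?g (rstar Y m a) = rstar X (?g m) (?h a)"
    if "a \<in> carrier (XA Y)" "m \<in> carrier (XM Y)" for a m
    using A[OF that(1)] M[OF that(2)] by (auto simp: inv1 inv2 f'(6-9)[symmetric])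
  ultimately have "?gh \<in> xmod_hom K Y X"
    using awb_hom_inverse[OF X.M.algebra_with_bracket_axioms f'(1) bij1]
      awb_hom_inverse[OF X.A.algebra_with_bracket_axioms f'(3) bij2]
    by (auto simp: xmod_hom_def)
  moreover have "Comp (xmod_cat K) X Y X ?gh f = Ident (xmod_cat K) X"
    by (auto simp: compose_def inv1 inv2 f_closed intro!: restrict_ext)
  moreover have "Comp (xmod_cat K) Y X Y f ?gh = Ident (xmod_cat K) Y"
    using bij1 bij2 by (auto simp: compose_def bij_betw_def f_inv_into_f intro!: restrict_ext)
  ultimately show ?thesis
    using f unfolding is_iso_def xmod_cat_simps by blast
qed

definition xmod_functor ::
    "(('k, 'a) cat1, 'a \<Rightarrow> 'a, ('k, 'a, 'a) xmod, ('a \<Rightarrow> 'a) \<times> ('a \<Rightarrow> 'a)) funct" where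
  "xmod_functor = \<lparr>obj_map = xmod_of_cat1, arr_map = (\<lambda>X Y f. xmod_of_cat1_hom X f)\<rparr>"

definition cat1_functor ::
    "('a \<times> 'a \<Rightarrow> 'a)
      \<Rightarrow> (('k, 'a, 'a) xmod, ('a \<Rightarrow> 'a) \<times> ('a \<Rightarrow> 'a), ('k, 'a) cat1, 'a \<Rightarrow> 'a) funct" where
  "cat1_functor enc =
    \<lparr>obj_map = cat1_of_xmod enc, arr_map = (\<lambda>X Y f. cat1_of_xmod_hom enc enc X f)\<rparr>"

lemma functor_simps [simp]:
  "obj_map xmod_functor X = xmod_of_cat1 X"
  "arr_map xmod_functor X Y f = xmod_of_cat1_hom X f"
  "obj_map (cat1_functor enc) Z = cat1_of_xmod enc Z"
  "arr_map (cat1_functor enc) Z W g = cat1_of_xmod_hom enc enc Z g"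
  by (simp_all add: xmod_functor_def cat1_functor_def)

lemma is_functor_xmod_functor:
  "is_functor (cat1_cat K :: (('k, 'u) cat1, 'u \<Rightarrow> 'u) cat) (xmod_cat K) xmod_functor"
proof
  fix X :: "('k, 'u) cat1" assume "X \<in> Ob (cat1_cat K)"
  then interpret X: cat1_algebra K X by (simp add: cat1_algebraI)
  show "obj_map xmod_functor X \<in> Ob (xmod_cat K)"
    by (simp add: X.crossed_module_xmod_of_cat1)
  show "arr_map xmod_functor X X (Ident (cat1_cat K) X) = Ident (xmod_cat K) (obj_map xmod_functor X)"
    by (auto simp: xmod_of_cat1_hom_def X.P_carrier X.src_kernel_carrier intro!: restrict_ext)
next
  fix X Y :: "('k, 'u) cat1" and f
  assume "X \<in> Ob (cat1_cat K)" "Y \<in> Ob (cat1_cat K)" "f \<in> Hom (cat1_cat K) X Y"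
  then show "arr_map xmod_functor X Y f
      \<in> Hom (xmod_cat K) (obj_map xmod_functor X) (obj_map xmod_functor Y)"
    by (simp add: xmod_of_cat1_hom_in_xmod_hom)
next
  fix X Y Z :: "('k, 'u) cat1" and f g
  assume XY: "X \<in> Ob (cat1_cat K)" "Y \<in> Ob (cat1_cat K)" "f \<in> Hom (cat1_cat K) X Y"
  then interpret X: cat1_algebra K X by (simp add: cat1_algebraI)
  have "f m \<in> src_kernel Y" if "m \<in> src_kernel X" for m
    using xmod_of_cat1_hom_in_xmod_hom[of K X Y f] XY that
    by (auto simp: xmod_hom_def xmod_of_cat1_hom_def dest: awb_hom_closed)
  moreover have "f p \<in> CP Y" if "p \<in> CP X" for p
    using XY that by (auto simp: cat1_hom_def)
  ultimately show "arr_map xmod_functor X Z (Comp (cat1_cat K) X Y Z g f) =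
      Comp (xmod_cat K) (obj_map xmod_functor X) (obj_map xmod_functor Y) (obj_map xmod_functor Z)
        (arr_map xmod_functor Y Z g) (arr_map xmod_functor X Y f)"
    by (auto simp: xmod_of_cat1_hom_def compose_def X.P_carrier X.src_kernel_carrier
        intro!: restrict_ext)
qed

lemma is_functor_cat1_functor:
  fixes enc :: "'u \<times> 'u \<Rightarrow> 'u" and K :: "('k, 'r) ring_scheme"
  assumes enc: "inj enc"
  shows "is_functor (xmod_cat K) (cat1_cat K) (cat1_functor enc)"
proof
  fix X :: "('k, 'u, 'u) xmod" assume "X \<in> Ob (xmod_cat K)"
  then interpret X: coded_crossed_module K X enc by (simp add: coded_crossed_moduleI enc)
  show "obj_map (cat1_functor enc) X \<in> Ob (cat1_cat K)"
    by (simp add: X.cat1_awb_cat1_of_xmod)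
  show "arr_map (cat1_functor enc) X X (Ident (xmod_cat K) X) =
      Ident (cat1_cat K) (obj_map (cat1_functor enc) X)"
    by (auto simp: cat1_of_xmod_hom_def intro!: restrict_ext)
next
  fix X Y :: "('k, 'u, 'u) xmod" and f
  assume "X \<in> Ob (xmod_cat K)" "Y \<in> Ob (xmod_cat K)" "f \<in> Hom (xmod_cat K) X Y"
  then show "arr_map (cat1_functor enc) X Y f
      \<in> Hom (cat1_cat K) (obj_map (cat1_functor enc) X) (obj_map (cat1_functor enc) Y)"
    by (simp add: cat1_of_xmod_hom_in_cat1_hom enc)
next
  fix X Y Z :: "('k, 'u, 'u) xmod" and f g
  assume XY: "X \<in> Ob (xmod_cat K)" "Y \<in> Ob (xmod_cat K)" "f \<in> Hom (xmod_cat K) X Y"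
  then interpret X: coded_crossed_module K X enc by (simp add: coded_crossed_moduleI enc)
  interpret Y: coded_crossed_module K Y enc using XY by (simp add: coded_crossed_moduleI enc)
  have "fst f m \<in> carrier (XM Y)" if "m \<in> carrier (XM X)" for m
    using XY that by (auto simp: xmod_hom_def dest: awb_hom_closed)
  moreover have "snd f a \<in> carrier (XA Y)" if "a \<in> carrier (XA X)" for a
    using XY that by (auto simp: xmod_hom_def dest: awb_hom_closed)
  ultimately show "arr_map (cat1_functor enc) X Z (Comp (xmod_cat K) X Y Z g f) =
      Comp (cat1_cat K) (obj_map (cat1_functor enc) X) (obj_map (cat1_functor enc) Y)
        (obj_map (cat1_functor enc) Z)
        (arr_map (cat1_functor enc) Y Z g) (arr_map (cat1_functor enc) X Y f)"
    by (auto simp: cat1_of_xmod_hom_def compose_def intro!: restrict_ext)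
qed

section \<open>The natural isomorphisms\<close>

text \<open>
  As \<open>s\<close> retracts \<open>R\<close> onto \<open>P\<close>, every \<open>x\<close> splits as \<open>(x - s x) + s x\<close>; this map undoes the splitting.
\<close>

definition recombine :: "('a \<times> 'a \<Rightarrow> 'c) \<Rightarrow> ('k, 'a) cat1 \<Rightarrow> 'c \<Rightarrow> 'a" where
  "recombine enc X =
    restrict (\<lambda>x. fst (decode enc x) \<oplus>\<^bsub>CR X\<^esub> snd (decode enc x))
      (carrier (semidirect_awb enc (xmod_of_cat1 X)))"

text \<open>
  The kernel of the source map of \<open>M \<rtimes> A\<close> consists of the pairs \<open>(m, 0)\<close> and its base of the pairs
  \<open>(0, a)\<close>, so dropping the zero entry identifies them with \<open>M\<close> and \<open>A\<close>.
\<close>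

definition components ::
    "('m \<times> 'a \<Rightarrow> 'c) \<Rightarrow> ('k, 'm, 'a) xmod \<Rightarrow> ('c \<Rightarrow> 'm) \<times> ('c \<Rightarrow> 'a)" where
  "components enc X =
    (restrict (\<lambda>x. fst (decode enc x)) (src_kernel (cat1_of_xmod enc X)),
     restrict (\<lambda>x. snd (decode enc x)) (CP (cat1_of_xmod enc X)))"

context cat1_algebra
begin

lemma coded_xmod:
  assumes "inj enc"
  shows "coded_crossed_module K (xmod_of_cat1 X) enc"
  using crossed_module_xmod_of_cat1 assms by (rule coded_crossed_moduleI)

lemma recombine_enc:
  assumes "inj enc" "m \<in> src_kernel X" "p \<in> CP X"
  shows "recombine enc X (enc (m, p)) = m \<oplus>\<^bsub>CR X\<^esub> p"
proof -
  interpret F: coded_crossed_module K "xmod_of_cat1 X" enc by (rule coded_xmod) fact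
  show ?thesis using assms(2,3) by (simp add: recombine_def)
qed

text \<open>
  Multiplicativity holds because the semidirect product was defined by distributing
  \<open>(m + p)(n + q)\<close> in \<open>R\<close>; compatibility with the target maps is \<open>t (m + p) = t m + p\<close>.
\<close>

lemma recombine_hom:
  assumes "inj enc"
  shows "recombine enc X \<in> cat1_hom K (cat1_of_xmod enc (xmod_of_cat1 X)) X"
proof -
  interpret F: coded_crossed_module K "xmod_of_cat1 X" enc by (rule coded_xmod) fact
  note enc = recombine_enc[OF assms]
  note carriers = P_carrier src_kernel_carrier
  note P = F.A.prod_closed F.A.bracket_closed F.A.M.a_closed F.A.smult_closed F.A.M.zero_closed
    F.M.prod_closed F.M.bracket_closed F.M.M.a_closed F.M.smult_closed F.M.M.zero_closed
  note closed = P[simplified]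
  have "recombine enc X \<in> awb_hom K F.S (CR X)"
    by (intro awb_homI)
      (auto simp: enc carriers closed src_kernel_absorbs R.linear_simps R.add_ac)
  then show ?thesis
    unfolding cat1_hom_def
    by (auto simp: enc carriers closed src_src_kernel src_simps tgt_simps) (simp add: recombine_def)
qed

lemma recombine_bij:
  assumes "inj enc"
  shows "bij_betw (recombine enc X) (carrier (CR (cat1_of_xmod enc (xmod_of_cat1 X)))) (carrier (CR X))"
proof -
  interpret F: coded_crossed_module K "xmod_of_cat1 X" enc by (rule coded_xmod) fact
  note enc = recombine_enc[OF assms]
  note carriers = P_carrier src_kernel_carrier
  show ?thesis
  proof (rule bij_betw_byWitness[where f' = "\<lambda>x. enc (x \<ominus>\<^bsub>CR X\<^esub> src X x, src X x)"])
    have part: "src X (m \<oplus>\<^bsub>CR X\<^esub> p) = p" "(m \<oplus>\<^bsub>CR X\<^esub> p) \<ominus>\<^bsub>CR X\<^esub> p = m"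
      if "m \<in> src_kernel X" "p \<in> CP X" for m p
      using that
      by (simp_all add: src_simps src_src_kernel carriers R.M.minus_eq R.M.a_assoc R.M.r_neg)
    show "\<forall>x \<in> carrier (CR (cat1_of_xmod enc (xmod_of_cat1 X))).
        enc (recombine enc X x \<ominus>\<^bsub>CR X\<^esub> src X (recombine enc X x), src X (recombine enc X x)) = x"
      by (auto simp: enc part)
    have "(x \<ominus>\<^bsub>CR X\<^esub> src X x) \<oplus>\<^bsub>CR X\<^esub> src X x = x" if "x \<in> carrier (CR X)" for x
      using that by (simp add: R.M.minus_eq R.M.a_assoc R.M.l_neg)
    then show "\<forall>x \<in> carrier (CR X). recombine enc X (enc (x \<ominus>\<^bsub>CR X\<^esub> src X x, src X x)) = x"
      by (simp add: enc src_kernel_part)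
  qed (auto simp: enc carriers src_kernel_part)
qed

end

context coded_crossed_module
begin

lemma src_kernel_cat1_of_xmod: "src_kernel C = enc ` (carrier (XM X) \<times> {\<zero>\<^bsub>XA X\<^esub>})"
  by (auto simp: src_kernel_def)

lemma components_enc [simp]:
  "m \<in> carrier (XM X) \<Longrightarrow> fst (components enc X) (enc (m, \<zero>\<^bsub>XA X\<^esub>)) = m"
  "a \<in> carrier (XA X) \<Longrightarrow> snd (components enc X) (enc (\<zero>\<^bsub>XM X\<^esub>, a)) = a"
  by (simp_all add: components_def src_kernel_cat1_of_xmod)

lemma components_hom: "components enc X \<in> xmod_hom K (xmod_of_cat1 C) X"
proof -
  have "fst (components enc X) \<in> awb_hom K (sub_awb S (src_kernel C)) (XM X)"
    "snd (components enc X) \<in> awb_hom K (sub_awb S (CP C)) (XA X)"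
    by (intro awb_homI; auto simp: src_kernel_cat1_of_xmod)+
  moreover have "fst (components enc X) \<in> extensional (src_kernel C)"
    "snd (components enc X) \<in> extensional (CP C)"
    unfolding components_def by simp_all
  ultimately show ?thesis
    unfolding xmod_hom_def
    by (auto simp: case_prod_beta src_kernel_cat1_of_xmod)
qed

lemma components_bij:
  "bij_betw (fst (components enc X)) (src_kernel C) (carrier (XM X))"
  "bij_betw (snd (components enc X)) (CP C) (carrier (XA X))"
  by (rule bij_betw_byWitness[where f' = "\<lambda>m. enc (m, \<zero>\<^bsub>XA X\<^esub>)"];
      auto simp: src_kernel_cat1_of_xmod)
    (rule bij_betw_byWitness[where f' = "\<lambda>a. enc (\<zero>\<^bsub>XM X\<^esub>, a)"]; auto)

end

lemma recombine_natural:
  fixes enc :: "'u \<times> 'u \<Rightarrow> 'u" and K :: "('k, 'r) ring_scheme"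
  assumes enc: "inj enc"
  shows "is_natural_iso (cat1_cat K) (cat1_cat K) (comp_funct (cat1_functor enc) xmod_functor) id_funct
    (recombine enc)"
  unfolding is_natural_iso_def
proof (intro conjI ballI)
  fix X :: "('k, 'u) cat1" assume "X \<in> Ob (cat1_cat K)"
  then interpret X: cat1_algebra K X by (simp add: cat1_algebraI)
  interpret F: coded_crossed_module K "xmod_of_cat1 X" enc by (rule X.coded_xmod[OF enc])
  show "is_iso (cat1_cat K) (obj_map (comp_funct (cat1_functor enc) xmod_functor) X)
      (obj_map id_funct X) (recombine enc X)"
    using cat1_iso_if_bij[OF F.cat1_awb_cat1_of_xmod X.cat1 X.recombine_hom[OF enc]
        X.recombine_bij[OF enc]]
    by (simp add: comp_funct_def id_funct_def)
next
  fix X Y :: "('k, 'u) cat1" and f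
  assume XY: "X \<in> Ob (cat1_cat K)" "Y \<in> Ob (cat1_cat K)" "f \<in> Hom (cat1_cat K) X Y"
  interpret X: cat1_algebra K X using XY by (simp add: cat1_algebraI)
  interpret Y: cat1_algebra K Y using XY by (simp add: cat1_algebraI)
  interpret F: coded_crossed_module K "xmod_of_cat1 X" enc by (rule X.coded_xmod[OF enc])
  have f: "f \<in> cat1_hom K X Y" using XY by simp
  have ker: "f m \<in> src_kernel Y" if "m \<in> src_kernel X" for m
    using xmod_of_cat1_hom_in_xmod_hom[of K X Y f] XY that
    by (auto simp: xmod_hom_def xmod_of_cat1_hom_def dest: awb_hom_closed)
  have "recombine enc Y (enc (f m, f p)) = f (recombine enc X (enc (m, p)))"
    if "m \<in> src_kernel X" "p \<in> CP X" for m p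
    using that cat1_homD(3)[OF f]
    by (simp add: X.recombine_enc[OF enc] Y.recombine_enc[OF enc] ker
        awb_hom_add[OF cat1_homD(1)[OF f]] X.P_carrier X.src_kernel_carrier)
  then show "Comp (cat1_cat K) (obj_map (comp_funct (cat1_functor enc) xmod_functor) X)
        (obj_map (comp_funct (cat1_functor enc) xmod_functor) Y) (obj_map id_funct Y)
        (recombine enc Y) (arr_map (comp_funct (cat1_functor enc) xmod_functor) X Y f) =
      Comp (cat1_cat K) (obj_map (comp_funct (cat1_functor enc) xmod_functor) X)
        (obj_map id_funct X) (obj_map id_funct Y) (arr_map id_funct X Y f) (recombine enc X)"
    by (auto simp: comp_funct_def id_funct_def compose_def cat1_of_xmod_hom_def
        xmod_of_cat1_hom_def intro!: restrict_ext)
qed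

lemma components_natural:
  fixes enc :: "'u \<times> 'u \<Rightarrow> 'u" and K :: "('k, 'r) ring_scheme"
  assumes enc: "inj enc"
  shows "is_natural_iso (xmod_cat K) (xmod_cat K) (comp_funct xmod_functor (cat1_functor enc)) id_funct
    (components enc)"
  unfolding is_natural_iso_def
proof (intro conjI ballI)
  fix X :: "('k, 'u, 'u) xmod" assume "X \<in> Ob (xmod_cat K)"
  then interpret X: coded_crossed_module K X enc by (simp add: coded_crossed_moduleI enc)
  interpret G: cat1_algebra K "cat1_of_xmod enc X"
    using X.cat1_awb_cat1_of_xmod by (rule cat1_algebraI)
  have "is_iso (xmod_cat K) (xmod_of_cat1 X.C) X (components enc X)"
    using G.crossed_module_xmod_of_cat1 X.crossed X.components_hom X.components_bij
    by (intro xmod_iso_if_bij) simp_all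
  then show "is_iso (xmod_cat K) (obj_map (comp_funct xmod_functor (cat1_functor enc)) X)
      (obj_map id_funct X) (components enc X)"
    by (simp add: comp_funct_def id_funct_def)
next
  fix X Y :: "('k, 'u, 'u) xmod" and f
  assume XY: "X \<in> Ob (xmod_cat K)" "Y \<in> Ob (xmod_cat K)" "f \<in> Hom (xmod_cat K) X Y"
  interpret X: coded_crossed_module K X enc using XY by (simp add: coded_crossed_moduleI enc)
  interpret Y: coded_crossed_module K Y enc using XY by (simp add: coded_crossed_moduleI enc)
  have "f \<in> xmod_hom K X Y" using XY by simp
  note f = xmod_homD[OF this]
  note f_simps = awb_hom_closed[OF f(1)] awb_hom_closed[OF f(3)]
    awb_hom_zero[OF f(1) X.M.abelian_group_A Y.M.abelian_group_A]
    awb_hom_zero[OF f(3) X.A.abelian_group_A Y.A.abelian_group_A]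
  show "Comp (xmod_cat K) (obj_map (comp_funct xmod_functor (cat1_functor enc)) X)
        (obj_map (comp_funct xmod_functor (cat1_functor enc)) Y) (obj_map id_funct Y)
        (components enc Y) (arr_map (comp_funct xmod_functor (cat1_functor enc)) X Y f) =
      Comp (xmod_cat K) (obj_map (comp_funct xmod_functor (cat1_functor enc)) X)
        (obj_map id_funct X) (obj_map id_funct Y) (arr_map id_funct X Y f) (components enc X)"
    by (auto simp: comp_funct_def id_funct_def compose_def cat1_of_xmod_hom_def
        xmod_of_cat1_hom_def X.src_kernel_cat1_of_xmod f_simps intro!: restrict_ext)
qed

theorem theorem3p12:
  fixes K :: "('k, 'r) ring_scheme"
  assumes "field K"
    and "infinite (UNIV :: 'u set)"
  shows "equivalent_categories
    (cat1_cat K :: (('k, 'u) cat1, 'u \<Rightarrow> 'u) cat)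
    (xmod_cat K :: (('k, 'u, 'u) xmod, ('u \<Rightarrow> 'u) \<times> ('u \<Rightarrow> 'u)) cat)"
proof -
  obtain enc :: "'u \<times> 'u \<Rightarrow> 'u" where enc: "inj enc"
    using card_of_Times_same_infinite[OF assms(2)]
    by (auto simp: card_of_ordIso[symmetric] bij_betw_def)
  show ?thesis
    unfolding equivalent_categories_def naturally_isomorphic_def
    using category_cat1_cat category_xmod_cat is_functor_xmod_functor
      is_functor_cat1_functor[OF enc] recombine_natural[OF enc] components_natural[OF enc]
    by blast
qed

end
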